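(* Let $M$ be a monoid that satisfies Property $(C_5)$. Suppose that for each $n>3$ there is some $k\ge 1$ such that $M$ satisfies the identity $$(x_1x_2\cdots x_{n^2-1}x_{n^2})\,\mathbf J_{n,k}\,(x_{n^2}x_{n^2-1}\cdots x_2x_1)\;\approx\;(x_1x_2\cdots x_{n^2-1}x_{n^2})\,\overline{\mathbf J_{n,k}}\,(x_{n^2}x_{n^2-1}\cdots x_2x_1).$$ Then $M$ is non-finitely based.
   Context: $\mathfrak A$ is a countably infinite alphabet of variables; words are elements of the free semigroup $\mathfrak A^+$ (or free monoid $\mathfrak A^*$). Monoids are regarded as semigroups. A semigroup $S$ satisfies an identity $\mathbf u\approx\mathbf v$ ($\mathbf u,\mathbf v\in\mathfrak A^+$) if $\Theta(\mathbf u)=\Theta(\mathbf v)$ for every substitution (homomorphism) $\Theta:\mathfrak A^+\to S$. A semigroup is finitely based if all its identities can be deduced from a finite subset of its identities, and non-finitely based otherwise. An island formed by a variable $x$ in a word $\mathbf u$ is a maximal (contiguous) subword of $\mathbf u$ which is a power of $x$. The height of a word over a two-letter alphabet is the number of its islands. Two words are of the same type if one is obtained from the other by changing the individual (positive) exponents of variables, i.e. they can be written as $c_1^{u_1}\cdots c_r^{u_r}$ and $c_1^{v_1}\cdots c_r^{v_r}$ with variables $c_i\neq c_{i+1}$ and all exponents $u_i,v_i\ge 1$. Property $(C_\ell)$ of a semigroup $S$: if $x\neq y$ are variables and $\mathbf u\in\{x,y\}^+$ has height at most $\ell$, then $\mathbf u$ can form an identity of $S$ only with a word of the same type; that is, whenever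 $S$ satisfies $\mathbf u\approx\mathbf v$ for a word $\mathbf v$, the word $\mathbf v$ is of the same type as $\mathbf u$. For $n>3$ and $k>0$, $$\mathbf J_{n,k}=(x_1^kx_{1+n}^k\cdots x_{1+n^2-n}^k)(x_2^kx_{2+n}^k\cdots x_{2+n^2-n}^k)\cdots(x_n^kx_{2n}^k\cdots x_{n^2}^k).$$ $\overline{\mathbf w}$ denotes the reverse of the word $\mathbf w$. *)

theory Defs
  imports "HOL-Algebra.Group"
begin

text \<open>The alphabet is \<^typ>\<open>nat\<close>, with the variable \<open>x\<^sub>i\<close> represented by \<open>i\<close>. Words are lists;
  the elements of the free semigroup are the nonempty lists.\<close>

type_synonym word = "nat list"

text \<open>The value of a nonempty word under the homomorphism into \<open>S\<close> that extends the assignment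
  \<open>\<theta>\<close> of the variables. Only the multiplication of \<open>S\<close> is used (not \<open>\<one>\<close>), so this makes sense for
  a semigroup; the value of the empty word is left unspecified.\<close>

fun word_val :: "('a, 'b) monoid_scheme \<Rightarrow> (nat \<Rightarrow> 'a) \<Rightarrow> word \<Rightarrow> 'a" where
  "word_val S \<theta> [] = undefined"
| "word_val S \<theta> [x] = \<theta> x"
| "word_val S \<theta> (x # y # w) = \<theta> x \<otimes>\<^bsub>S\<^esub> word_val S \<theta> (y # w)"

definition satisfies :: "('a, 'b) monoid_scheme \<Rightarrow> word \<Rightarrow> word \<Rightarrow> bool" where
  "satisfies S u v \<longleftrightarrow> u \<noteq> [] \<and> v \<noteq> [] \<and>
     (\<forall>\<theta> \<in> UNIV \<rightarrow> carrier S. word_val S \<theta> u = word_val S \<theta> v)"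

definition identities_of :: "('a, 'b) monoid_scheme \<Rightarrow> (word \<times> word) set" where
  "identities_of S = {(u, v). satisfies S u v}"

text \<open>Deducibility of semigroup identities, i.e. the rules of equational logic read modulo
  associativity. Substitutions are endomorphisms of the free semigroup, so they map every variable
  to a nonempty word.\<close>

inductive deducible :: "(word \<times> word) set \<Rightarrow> word \<Rightarrow> word \<Rightarrow> bool" for \<Sigma> where
  ax: "(u, v) \<in> \<Sigma> \<Longrightarrow> deducible \<Sigma> u v"
| refl: "u \<noteq> [] \<Longrightarrow> deducible \<Sigma> u u"
| sym: "deducible \<Sigma> u v \<Longrightarrow> deducible \<Sigma> v u"
| trans: "deducible \<Sigma> u v \<Longrightarrow> deducible \<Sigma> v w \<Longrightarrow> deducible \<Sigma> u w"
| mult: "deducible \<Sigma> u v \<Longrightarrow> deducible \<Sigma> u' v' \<Longrightarrow> deducible \<Sigma> (u @ u') (v @ v')"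
| subst: "deducible \<Sigma> u v \<Longrightarrow> \<forall>x. \<phi> x \<noteq> [] \<Longrightarrow>
    deducible \<Sigma> (concat (map \<phi> u)) (concat (map \<phi> v))"

definition finitely_based :: "('a, 'b) monoid_scheme \<Rightarrow> bool" where
  "finitely_based S \<longleftrightarrow>
     (\<exists>\<Sigma>. finite \<Sigma> \<and> \<Sigma> \<subseteq> identities_of S \<and> (\<forall>(u, v) \<in> identities_of S. deducible \<Sigma> u v))"

text \<open>An island is recorded together with its position: the triple \<open>(p, q, s)\<close> stands for the
  occurrence of \<open>q\<close> in \<open>w = p q s\<close>. Equal powers at different places are different islands.\<close>

definition islands_of :: "nat \<Rightarrow> word \<Rightarrow> (word \<times> word \<times> word) set" where
  "islands_of x w = {(p, q, s). w = p @ q @ s \<and> (\<exists>m \<ge> 1. q = replicate m x) \<and>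
     (p = [] \<or> last p \<noteq> x) \<and> (s = [] \<or> hd s \<noteq> x)}"

definition height :: "word \<Rightarrow> nat" where
  "height w = card (\<Union>x. islands_of x w)"

definition power_word :: "nat list \<Rightarrow> nat list \<Rightarrow> word" where
  "power_word cs es = concat (map2 (\<lambda>c e. replicate e c) cs es)"

definition same_type :: "word \<Rightarrow> word \<Rightarrow> bool" where
  "same_type u v \<longleftrightarrow>
     (\<exists>cs us vs. length us = length cs \<and> length vs = length cs \<and> distinct_adj cs \<and>
        (\<forall>e \<in> set us \<union> set vs. e \<ge> 1) \<and> u = power_word cs us \<and> v = power_word cs vs)"

definition property_C :: "nat \<Rightarrow> ('a, 'b) monoid_scheme \<Rightarrow> bool" where
  "property_C l S \<longleftrightarrow>
     (\<forall>x y u v. x \<noteq> y \<longrightarrow> u \<noteq> [] \<longrightarrow> set u \<subseteq> {x, y} \<longrightarrow> height u \<le> l \<longrightarrow>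
        satisfies S u v \<longrightarrow> same_type u v)"

definition J_word :: "nat \<Rightarrow> nat \<Rightarrow> word" where
  "J_word n k = concat (map (\<lambda>i. concat (map (\<lambda>j. replicate k (i + j * n)) [0..<n])) [1..<n+1])"

definition linear_word :: "nat \<Rightarrow> word" where
  "linear_word n = [1..<n\<^sup>2 + 1]"

end

theory Submission
  imports Defs
begin

text \<open>Up to type, a word over two letters is what remains after shrinking every island to a single letter,
that is, its image under \<^const>\<open>remdups_adj\<close>. Since \<open>M\<close> is a monoid, letters of an identity of
\<open>M\<close> may be deleted, so Property \<open>(C\<^sub>5)\<close> says: whenever a substitution \<open>\<phi>\<close> into words over two
letters gives \<open>\<phi>(u)\<close> at most five islands, \<open>\<phi>(v)\<close> has the same type as \<open>\<phi>(u)\<close>. The argument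
is a combinatorial one about this relation between \<open>u\<close> and \<open>v\<close>, called \<open>type_faithful\<close> below.

Let \<open>\<Sigma>\<close> be a finite set of identities of \<open>M\<close>, in at most \<open>r\<close> letters each, and let \<open>n\<close> exceed
\<open>r\<close> by a few units. Delete the last letter of the \<open>n \<times> n\<close> grid from the given identity and number
the others \<open>0, ..., m - 1\<close>. Up to positive exponents the left-hand side is then the zigzag
\<open>\<gamma> = 0 1 ... (m - 1) \<cdot> \<tau>(0) ... \<tau>(m - 1) \<cdot> (m - 1) ... 1 0\<close>, where \<open>\<tau>\<close> reads the grid by columns
instead of rows: every letter has a first, a middle and a last place in it. The right-hand side is no
such word (\<open>not_follows_zigzag_rev\<close>): there the reversed middle part ends with \<open>0\<close>, so that the
places of the zigzag after the middle one of \<open>0\<close> would all have to be found in the final descent;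
they contain the letter \<open>n\<close> twice, but the descent contains it once. So it is enough that the
identities in \<open>\<Sigma>\<close> turn zigzag words into zigzag words (\<open>follows_zigzag_preserved\<close>).

Let \<open>A = p \<Theta>(u) q\<close> be a zigzag word and \<open>B = p \<Theta>(v) q\<close>, with \<open>u \<approx> v\<close> in \<open>\<Sigma>\<close>. Letters that are
neighbours when the grid is read by rows are not neighbours when it is read by columns, so no ordered
pair of letters is adjacent twice in \<open>\<gamma>\<close>. Hence the image of a letter that occurs twice in \<open>u\<close> is a power of one
letter, and since \<open>u\<close> has few letters, every stretch of \<open>A\<close> with many different letters contains a
change of letter inside the image of a letter that occurs only once in \<open>u\<close>. New letters, called
markers, can be inserted at all these places at the same time: this only modifies \<open>\<Theta>\<close>, so the
result is again an identity to which \<open>(C\<^sub>5)\<close> applies (\<open>insert_markers\<close>). The grid is so large that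
each letter has a marker between its first and its middle place, and another one between its middle
and its last place.

Two letters \<open>i < j\<close> alternate in \<open>A\<close> as \<open>i j i j i\<close>, with exactly five islands. Replacing a suitable
marker by \<open>i\<close> or by \<open>j\<close> does not increase this number, so it does not do so in \<open>B\<close> either, and the
marker cannot lie inside an island of the other letter in \<open>B\<close>. This determines how the markers of
\<open>i\<close> and of \<open>j\<close> divide the islands of \<open>B\<close> (\<open>pair_cuts\<close>). Consequently the markers split the
occurrences of every letter of \<open>B\<close> into first, middle and last ones in such a way that any two
letters are ordered as in \<open>\<gamma>\<close>, and \<open>B\<close> is a zigzag word (\<open>follows_zigzag_erased\<close>).\<close>

section \<open>Shrinking islands\<close>

lemma remdups_adj_append_mid: "remdups_adj (xs @ remdups_adj u @ ys) = remdups_adj (xs @ u @ ys)"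
proof -
  have 1: "remdups_adj (remdups_adj u @ ys) = remdups_adj (u @ ys)" for u ys :: "'a list"
  proof (induction u rule: remdups_adj.induct)
    case (3 x y zs)
    show ?case
    proof (cases "x = y")
      case False
      have "remdups_adj (y # zs) = y # tl (remdups_adj (y # zs))" by simp
      then show ?thesis using 3(2)[OF False] False
        by (metis append_Cons remdups_adj.simps(3))
    qed (use 3(1) in simp)
  qed auto
  show ?thesis
  proof (induction xs)
    case (Cons a xs)
    then show ?case by (simp add: remdups_adj_Cons)
  qed (simp add: 1)
qed

lemma remdups_adj_context_cong:
  "remdups_adj u = remdups_adj v \<Longrightarrow> remdups_adj (xs @ u @ ys) = remdups_adj (xs @ v @ ys)"
  by (metis remdups_adj_append_mid)

lemma length_remdups_adj_append_ge:
  "length (remdups_adj u) \<le> length (remdups_adj (xs @ u @ ys))"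
proof -
  have 1: "length (remdups_adj u) \<le> length (remdups_adj (xs @ u))" for xs u :: "'a list"
    by (induction xs) (auto simp: remdups_adj_Cons split: list.splits)
  have "length (remdups_adj u) \<le> length (remdups_adj (rev ys @ rev u))"
    using 1[of "rev u" "rev ys"] by simp
  also have "\<dots> = length (remdups_adj (u @ ys))"
    by (metis length_rev remdups_adj_rev rev_append)
  also have "\<dots> \<le> length (remdups_adj (xs @ u @ ys))" by (rule 1)
  finally show ?thesis .
qed

lemma remdups_adj_eq_ConsE:
  assumes "remdups_adj w = a # t"
  obtains e w' where "e \<ge> 1" "w = replicate e a @ w'" "remdups_adj w' = t"
proof -
  have "\<exists>e w'. e \<ge> 1 \<and> w = replicate e a @ w' \<and> remdups_adj w' = t"
    using assms
  proof (induction w rule: remdups_adj.induct)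
    case (2 x)
    then show ?case by (intro exI[of _ 1] exI[of _ "[]"]) auto
  next
    case (3 x y xs)
    show ?case
    proof (cases "x = y")
      case True
      with 3 obtain e w' where "e \<ge> 1" "y # xs = replicate e a @ w'" "remdups_adj w' = t" by auto
      moreover have "a = x" using 3(3) True
        by (metis list.sel(1) hd_remdups_adj)
      ultimately show ?thesis by (intro exI[of _ "Suc e"] exI[of _ w']) auto
    next
      case False
      with 3(3) show ?thesis by (intro exI[of _ 1] exI[of _ "y # xs"]) auto
    qed
  qed auto
  then show thesis using that by blast
qed

section \<open>Height and type\<close>

text \<open>An island is determined by the number of islands before it; hence counting islands is bounded by the
length of the shrunken word.\<close>

lemma islands_unique:
  assumes "(p, q, s) \<in> islands_of x w" "(p', q', s') \<in> islands_of x' w"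
    and "length (remdups_adj p) = length (remdups_adj p')"
  shows "(p, q, s) = (p', q', s')"
proof -
  have le: "length p' \<le> length p" if "(p, q, s) \<in> islands_of x w" "(p', q', s') \<in> islands_of x' w"
    and "length (remdups_adj p) = length (remdups_adj p')" for p q s x p' q' s' x'
  proof (rule ccontr)
    assume "\<not> ?thesis"
    moreover have "p @ q @ s = p' @ q' @ s'" using that by (auto simp: islands_of_def)
    ultimately obtain d where d: "p' = p @ d" "d \<noteq> []" "q @ s = d @ q' @ s'"
      unfolding append_eq_append_conv2[of p] by auto
    from that(1) obtain k where "q = replicate k x" "1 \<le> k" by (auto simp: islands_of_def)
    then obtain k where "q = replicate (Suc k) x" by (cases k) auto
    then have "hd d = x" using d by (metis append_Cons hd_append2 list.sel(1) replicate_Suc)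
    then have "p = [] \<or> last p \<noteq> hd d" using that(1) by (auto simp: islands_of_def)
    then have "remdups_adj p' = remdups_adj p @ remdups_adj d"
      using d remdups_adj_append'[of p d] by blast
    then show False using that(3) d by simp
  qed
  have "length p = length p'" using le[OF assms] le[OF assms(2,1) assms(3)[symmetric]] by simp
  moreover have "p @ q @ s = p' @ q' @ s'" using assms by (auto simp: islands_of_def)
  ultimately have p: "p = p'" and qs: "q @ s = q' @ s'" by (auto simp: append_eq_append_conv)
  have tw: "takeWhile (\<lambda>z. z = x) (q @ s) = q" "x = hd (q @ s)" if "(p, q, s) \<in> islands_of x w" for p q s x
  proof -
    from that obtain k where "k \<ge> 1" "q = replicate k x" "s = [] \<or> hd s \<noteq> x"
      by (auto simp: islands_of_def)
    then show "takeWhile (\<lambda>z. z = x) (q @ s) = q" "x = hd (q @ s)"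
      by (cases s; cases k; auto simp: takeWhile_append)+
  qed
  have "q = q'" using tw[OF assms(1)] tw[OF assms(2)] qs by metis
  then show ?thesis using p qs by simp
qed

lemma height_le: "height w \<le> length (remdups_adj w)"
proof -
  let ?f = "\<lambda>(p, q, s). length (remdups_adj (p :: word))"
  let ?I = "\<Union>x. islands_of x w"
  have "inj_on ?f ?I"
    by (rule inj_onI) (auto dest: islands_unique)
  moreover have "?f ` ?I \<subseteq> {..<length (remdups_adj w)}"
  proof -
    have "length (remdups_adj p) < length (remdups_adj w)" if "(p, q, s) \<in> islands_of x w" for p q s x
    proof -
      from that obtain k where *: "k \<ge> 1" "q = replicate k x" "w = p @ q @ s" "p = [] \<or> last p \<noteq> x"
        by (auto simp: islands_of_def)
      then have "q @ s \<noteq> []" "hd (q @ s) = x" by (cases k; auto)+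
      then have "remdups_adj w = remdups_adj p @ remdups_adj (q @ s)" "remdups_adj (q @ s) \<noteq> []"
        using * remdups_adj_append'[of p "q @ s"] by auto
      then show ?thesis by simp
    qed
    then show ?thesis by auto
  qed
  ultimately have "card ?I \<le> card {..<length (remdups_adj w)}"
    by (intro card_inj_on_le[of ?f]) auto
  then show ?thesis by (simp add: height_def)
qed

lemma remdups_adj_power_word:
  assumes "length es = length cs" "\<forall>e\<in>set es. e \<ge> 1" "distinct_adj cs"
  shows "remdups_adj (power_word cs es) = cs"
  using assms
proof (induction cs arbitrary: es)
  case (Cons c cs)
  then obtain e es' where es: "es = e # es'" by (cases es) auto
  have IH: "remdups_adj (power_word cs es') = cs" using Cons es by (auto simp: distinct_adj_Cons)
  have e: "replicate e c \<noteq> []" "last (replicate e c) = c" using Cons.prems es by auto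
  have rep: "remdups_adj (replicate e c) = [c]" using Cons.prems es by (simp add: remdups_adj_replicate)
  have pw: "power_word (c # cs) es = replicate e c @ power_word cs es'"
    by (simp add: es power_word_def)
  show ?case
  proof (cases "cs = []")
    case True
    then show ?thesis using pw rep by (simp add: power_word_def)
  next
    case False
    then have "power_word cs es' \<noteq> []" "hd (power_word cs es') = hd cs"
      using IH by (metis hd_remdups_adj remdups_adj.simps(1))+
    moreover have "hd cs \<noteq> c" using Cons.prems(3) False by (auto simp: distinct_adj_Cons)
    ultimately show ?thesis using pw rep e IH
      by (metis append_Cons append_Nil remdups_adj_append')
  qed
qed (simp add: power_word_def)

lemma same_type_remdups_adj: "same_type u v \<Longrightarrow> remdups_adj u = remdups_adj v"
  unfolding same_type_def by (force simp: remdups_adj_power_word)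

section \<open>What Property (C5) says about the identities of a monoid\<close>

text \<open>The values of \<open>\<phi>\<close> may be empty, and \<open>x = y\<close> is allowed. The relation is not symmetric: only the
height of the image of \<open>u\<close> is bounded.\<close>

definition type_faithful :: "word \<Rightarrow> word \<Rightarrow> bool" where
  "type_faithful u v \<longleftrightarrow> (\<forall>(\<phi> :: nat \<Rightarrow> word) x y. (\<forall>z. set (\<phi> z) \<subseteq> {x, y}) \<longrightarrow>
     length (remdups_adj (concat (map \<phi> u))) \<le> 5 \<longrightarrow>
     remdups_adj (concat (map \<phi> v)) = remdups_adj (concat (map \<phi> u)))"

text \<open>The value of a word, with \<open>\<one>\<close> for the empty word: this makes evaluation compatible with
substitutions that delete letters.\<close>

fun monoid_val :: "('a, 'b) monoid_scheme \<Rightarrow> (nat \<Rightarrow> 'a) \<Rightarrow> word \<Rightarrow> 'a" where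
  "monoid_val S \<theta> [] = \<one>\<^bsub>S\<^esub>"
| "monoid_val S \<theta> (x # w) = \<theta> x \<otimes>\<^bsub>S\<^esub> monoid_val S \<theta> w"

context
  fixes M :: "('a, 'b) monoid_scheme" (structure)
  assumes monoid: "monoid M"
begin

lemma monoid_val_closed: "\<theta> \<in> UNIV \<rightarrow> carrier M \<Longrightarrow> monoid_val M \<theta> w \<in> carrier M"
  using monoid by (induction w) (auto simp: Pi_iff intro!: monoid.m_closed monoid.one_closed)

lemma monoid_val_append: "\<theta> \<in> UNIV \<rightarrow> carrier M \<Longrightarrow>
   monoid_val M \<theta> (u @ v) = monoid_val M \<theta> u \<otimes> monoid_val M \<theta> v"
proof (induction u)
  case (Cons a u)
  then show ?case using monoid monoid_val_closed[OF Cons.prems]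
    by (simp add: monoid.m_assoc Pi_iff)
qed (simp add: monoid.l_one[OF monoid] monoid_val_closed)

lemma monoid_val_concat: "\<theta> \<in> UNIV \<rightarrow> carrier M \<Longrightarrow>
   monoid_val M \<theta> (concat (map \<phi> w)) = monoid_val M (\<lambda>x. monoid_val M \<theta> (\<phi> x)) w"
  by (induction w) (auto simp: monoid_val_append)

lemma word_val_eq_monoid_val:
  "\<theta> \<in> UNIV \<rightarrow> carrier M \<Longrightarrow> w \<noteq> [] \<Longrightarrow> word_val M \<theta> w = monoid_val M \<theta> w"
proof (induction w rule: induct_list012)
  case (2 x)
  then show ?case by (simp add: monoid.r_one[OF monoid] Pi_iff)
qed auto

lemma satisfies_monoid_val:
  "satisfies M u v \<longleftrightarrow> u \<noteq> [] \<and> v \<noteq> [] \<and> (\<forall>\<theta> \<in> UNIV \<rightarrow> carrier M. monoid_val M \<theta> u = monoid_val M \<theta> v)"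
  by (auto simp: satisfies_def word_val_eq_monoid_val)

text \<open>If no letter of \<open>u\<close> or of \<open>v\<close> survives the substitution, Property \<open>(C\<^sub>5)\<close> cannot be applied directly,
because identities hold between nonempty words. Putting a single letter in front, once \<open>x\<close> and once
another letter, shows that the other side is empty as well.\<close>

lemma satisfies_imp_type_faithful:
  assumes C: "property_C 5 M" and sat: "satisfies M u v"
  shows "type_faithful u v"
  unfolding type_faithful_def
proof (intro allI impI)
  fix \<phi> :: "nat \<Rightarrow> word" and x y
  assume sub: "\<forall>z. set (\<phi> z) \<subseteq> {x, y}" 
    and le: "length (remdups_adj (concat (map \<phi> u))) \<le> 5"
  \<comment> \<open>Property \<open>(C\<^sub>5)\<close> is about two different letters, so a missing one is supplied if \<open>x = y\<close>.\<close>
  obtain y' where y': "x \<noteq> y'" "y' = y \<or> y = x" by (metis n_not_Suc_n)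
  have sub': "set (concat (map \<phi> w)) \<subseteq> {x, y'}" for w using sub y' by fastforce
  have val: "monoid_val M \<theta> (concat (map \<phi> u)) = monoid_val M \<theta> (concat (map \<phi> v))"
    if \<theta>: "\<theta> \<in> UNIV \<rightarrow> carrier M" for \<theta>
  proof -
    have "(\<lambda>x. monoid_val M \<theta> (\<phi> x)) \<in> UNIV \<rightarrow> carrier M" using monoid_val_closed[OF \<theta>] by auto
    then show ?thesis using sat unfolding satisfies_monoid_val monoid_val_concat[OF \<theta>] by blast
  qed
  have forced: "remdups_adj b = remdups_adj a"
    if "a \<noteq> []" "b \<noteq> []" "set a \<subseteq> {x, y'}" "length (remdups_adj a) \<le> 5"
      "\<And>\<theta>. \<theta> \<in> UNIV \<rightarrow> carrier M \<Longrightarrow> monoid_val M \<theta> a = monoid_val M \<theta> b" for a b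
  proof -
    have "satisfies M a b" using that by (simp add: satisfies_monoid_val)
    moreover have "height a \<le> 5" using height_le[of a] that(4) by simp
    ultimately have "same_type a b" using C y'(1) that unfolding property_C_def by blast
    then show ?thesis by (simp add: same_type_remdups_adj)
  qed
  have empty: "b = []"
    if "set b \<subseteq> {x, y'}" "\<And>\<theta>. \<theta> \<in> UNIV \<rightarrow> carrier M \<Longrightarrow> monoid_val M \<theta> [] = monoid_val M \<theta> b" for b
  proof -
    have eq: "remdups_adj (c # b) = remdups_adj [c]" if "c \<in> {x, y'}" for c
    proof (rule forced)
      show "monoid_val M \<theta> [c] = monoid_val M \<theta> (c # b)" if "\<theta> \<in> UNIV \<rightarrow> carrier M" for \<theta>
        using \<open>\<And>\<theta>. \<theta> \<in> UNIV \<rightarrow> carrier M \<Longrightarrow> monoid_val M \<theta> [] = monoid_val M \<theta> b\<close>[OF that] by simp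
    qed (use that in auto)
    have "set b \<subseteq> {c}" if "c \<in> {x, y'}" for c
      using eq[OF that] by (metis remdups_adj_set list.set(1,2) remdups_adj.simps(2) set_subset_Cons)
    then show ?thesis using y' by (metis insertCI last_in_set singletonD subsetD)
  qed
  show "remdups_adj (concat (map \<phi> v)) = remdups_adj (concat (map \<phi> u))"
  proof (cases "concat (map \<phi> u) = [] \<or> concat (map \<phi> v) = []")
    case True
    then have "concat (map \<phi> u) = [] \<and> concat (map \<phi> v) = []"
      using empty[of "concat (map \<phi> u)"] empty[of "concat (map \<phi> v)"] val sub' by metis
    then show ?thesis by metis
  next
    case False
    then show ?thesis using forced[of "concat (map \<phi> u)" "concat (map \<phi> v)"] val sub' le by blast
  qed
qed

end

lemma type_faithful_subst:
  assumes "type_faithful u v"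
  shows "type_faithful (concat (map \<Theta> u)) (concat (map \<Theta> v))"
  unfolding type_faithful_def
proof (intro allI impI)
  fix \<phi> :: "nat \<Rightarrow> word" and x y
  have eq: "concat (map \<phi> (concat (map \<Theta> w))) = concat (map (\<lambda>z. concat (map \<phi> (\<Theta> z))) w)" for w
    by (induction w) auto
  assume sub: "\<forall>z. set (\<phi> z) \<subseteq> {x, y}" 
    and le: "length (remdups_adj (concat (map \<phi> (concat (map \<Theta> u))))) \<le> 5"
  have "\<forall>z. set (concat (map \<phi> (\<Theta> z))) \<subseteq> {x, y}" using sub by auto
  then show "remdups_adj (concat (map \<phi> (concat (map \<Theta> v)))) =
      remdups_adj (concat (map \<phi> (concat (map \<Theta> u))))"
    using assms le unfolding type_faithful_def eq by metis
qed

lemma type_faithful_context: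
  assumes "type_faithful u v"
  shows "type_faithful (p @ u @ q) (p @ v @ q)"
  unfolding type_faithful_def
proof (intro allI impI)
  fix \<phi> :: "nat \<Rightarrow> word" and x y
  assume sub: "\<forall>z. set (\<phi> z) \<subseteq> {x, y}" 
    and le: "length (remdups_adj (concat (map \<phi> (p @ u @ q)))) \<le> 5"
  have "length (remdups_adj (concat (map \<phi> u))) \<le> 5"
    using le length_remdups_adj_append_ge[of "concat (map \<phi> u)" "concat (map \<phi> p)" "concat (map \<phi> q)"]
    by simp
  then have "remdups_adj (concat (map \<phi> v)) = remdups_adj (concat (map \<phi> u))"
    using assms sub unfolding type_faithful_def by blast
  then show "remdups_adj (concat (map \<phi> (p @ v @ q))) = remdups_adj (concat (map \<phi> (p @ u @ q)))"
    using remdups_adj_context_cong by simp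
qed

lemma type_faithfulD:
  fixes \<phi> :: "nat \<Rightarrow> word"
  assumes "type_faithful u v" "\<And>z. set (\<phi> z) \<subseteq> {x, y}" 
    "remdups_adj (concat (map \<phi> u)) = t" "length t \<le> 5"
  shows "remdups_adj (concat (map \<phi> v)) = t"
  using assms(1)[unfolded type_faithful_def, rule_format, of \<phi> x y] assms(2-4) by simp

text \<open>Substituting a word of two different letters for \<open>t\<close> counts its occurrences: \<open>(x y)\<^sup>c\<close> has \<open>2 c\<close>
islands.\<close>

lemma type_faithful_linear:
  assumes T: "type_faithful u v" and "count_list u t = 1"
  shows "count_list v t = 1"
proof -
  let ?\<phi> = "\<lambda>z. if z = t then [t, Suc t] else []"
  have *: "concat (map ?\<phi> w) = concat (replicate (count_list w t) [t, Suc t])" for w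
    by (induction w) auto
  have "remdups_adj (concat (map ?\<phi> v)) = [t, Suc t]"
    by (rule type_faithfulD[OF T, where x = t and y = "Suc t"]) (use assms(2) * in auto)
  moreover have "distinct_adj (concat (replicate c [t, Suc t]))" for c
  proof (induction c)
    case (Suc c)
    then show ?case by (cases c) auto
  qed simp
  ultimately have "concat (replicate (count_list v t) [t, Suc t]) = [t, Suc t]"
    by (metis * distinct_adj_altdef)
  from arg_cong[OF this, of length] show ?thesis
    by (simp add: length_concat sum_list_replicate)
qed

lemma type_faithful_set:
  assumes T: "type_faithful u v"
  shows "set v = set u"
proof -
  have "t \<in> set v \<longleftrightarrow> t \<in> set u" for t
  proof -
  let ?\<phi> = "\<lambda>z. if z = t then [t] else []"
  have *: "concat (map ?\<phi> w) = replicate (count_list w t) t" for w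
    by (induction w) auto
  have "remdups_adj (concat (map ?\<phi> v)) = remdups_adj (concat (map ?\<phi> u))"
    by (rule type_faithfulD[OF T, where x = t and y = t]) (auto simp: * remdups_adj_replicate)
  then show ?thesis
    by (auto simp: * remdups_adj_replicate count_list_0_iff split: if_splits)
  qed
  then show ?thesis by blast
qed

section \<open>Labels and markers\<close>

text \<open>Words are described by sorted lists of labels, which stand for places of the zigzag. The label \<open>a\<close>
becomes the half-label \<open>2 a\<close>; a marker between a place labelled \<open>a\<close> and a later one becomes \<open>2 a + 1\<close>,
so that sorting half-labels puts markers where they belong. A marker is inserted wherever the label
changes inside the list; changes between different lists get no marker.\<close>

fun half_labels :: "nat list \<Rightarrow> nat list" where
  "half_labels [] = []"
| "half_labels [a] = [2 * a]"
| "half_labels (a # b # ls) = 2 * a # (if a < b then [2 * a + 1] else []) @ half_labels (b # ls)"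

text \<open>Sortedness in which only even numbers may be repeated: places carry powers of letters, but every
marker occurs once.\<close>

definition half_before :: "nat \<Rightarrow> nat \<Rightarrow> bool" where
  "half_before g h \<longleftrightarrow> g < h \<or> g = h \<and> even g"

lemma half_labelsE:
  assumes "h \<in> set (half_labels ls)"
  obtains a where "a \<in> set ls" "h = 2 * a" 
  | a b where "a \<in> set ls" "b \<in> set ls" "a < b" "h = 2 * a + 1"
proof -
  have "\<exists>a\<in>set ls. h = 2 * a \<or> (h = 2 * a + 1 \<and> (\<exists>b\<in>set ls. a < b))"
    using assms by (induction ls rule: half_labels.induct) (auto split: if_splits)
  then show thesis using that by blast
qed

lemma even_half_labels: "a \<in> set ls \<Longrightarrow> 2 * a \<in> set (half_labels ls)"
  by (induction ls rule: half_labels.induct) auto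

lemma odd_half_labels:
  "sorted ls \<Longrightarrow> a \<in> set ls \<Longrightarrow> Suc a \<in> set ls \<Longrightarrow> 2 * a + 1 \<in> set (half_labels ls)"
proof (induction ls rule: half_labels.induct)
  case (3 x b ls)
  show ?case
  proof (cases "a \<in> set (b # ls)")
    case True
    show ?thesis
    proof (cases "Suc a = x")
      case True
      with \<open>a \<in> set (b # ls)\<close> have "x \<le> a" using 3(2) by auto
      with True show ?thesis by simp
    qed (use 3 True in auto)
  next
    case False
    then have "x = a" "b = Suc a" using 3 by auto
    then show ?thesis by simp
  qed
qed auto

lemma sorted_half_labels_concat:
  "sorted (concat Ss) \<Longrightarrow> sorted_wrt half_before (concat (map half_labels Ss))"
proof (induction Ss)
  case (Cons S Ss)
  have "sorted_wrt half_before (half_labels S)" if "sorted S" for S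
    using that
  proof (induction S rule: half_labels.induct)
    case (3 a b S)
    have "half_before (2 * a) h" if "h \<in> set (half_labels (b # S))" for h
      using that by (rule half_labelsE) (use 3(2) in \<open>auto simp: half_before_def\<close>)
    moreover have "half_before (2 * a + 1) h" if "h \<in> set (half_labels (b # S))" "a < b" for h
      using that(1) by (rule half_labelsE) (use 3(2) that(2) in \<open>auto simp: half_before_def\<close>)
    ultimately show ?case using 3 by (auto simp: half_before_def)
  qed auto
  moreover have "half_before g h" if g: "g \<in> set (half_labels S)" and h: "h \<in> set (concat (map half_labels Ss))" for g h
  proof -
    have le: "a \<le> b" if "a \<in> set S" "b \<in> set (concat Ss)" for a b
      using Cons.prems that by (auto simp: sorted_append)
    obtain S' where "S' \<in> set Ss" "h \<in> set (half_labels S')" using h by auto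
    from this(2) have "\<exists>b\<in>set S'. h = 2 * b \<or> h = 2 * b + 1"
      by (rule half_labelsE) auto
    then obtain b where b: "b \<in> set (concat Ss)" "h = 2 * b \<or> h = 2 * b + 1"
      using \<open>S' \<in> set Ss\<close> by auto
    from g show ?thesis
    proof (rule half_labelsE)
      fix a assume "a \<in> set S" "g = 2 * a"
      then show ?thesis using le[of a b] b by (auto simp: half_before_def)
    next
      fix a a' assume "a' \<in> set S" "a < a'" "g = 2 * a + 1"
      then show ?thesis using le[of a' b] b by (auto simp: half_before_def)
    qed
  qed
  ultimately show ?case using Cons by (auto simp: sorted_append sorted_wrt_append)
qed auto

lemma half_before_sorted: "sorted_wrt half_before hs \<Longrightarrow> sorted hs"
  by (erule sorted_wrt_mono_rel[rotated]) (auto simp: half_before_def)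

lemma half_before_count_odd:
  "sorted_wrt half_before hs \<Longrightarrow> odd h \<Longrightarrow> h \<in> set hs \<Longrightarrow> count_list hs h = 1"
proof (induction hs)
  case (Cons g hs)
  have "g \<notin> set hs" if "odd g" using Cons.prems(1) that by (auto simp: half_before_def)
  then show ?case using Cons by (auto simp: count_list_0_iff)
qed auto

text \<open>A repeated entry contributes a power of one letter, because its image has length at most one; an image
\<open>[a, b]\<close> would add two islands with each repetition.\<close>

lemma remdups_adj_concat_map:
  assumes "\<And>x. x \<in> set xs \<Longrightarrow> length (\<psi> x) \<le> 1"
  shows "remdups_adj (concat (map \<psi> xs)) = remdups_adj (concat (map \<psi> (remdups_adj xs)))"
  using assms
proof (induction xs rule: remdups_adj.induct)
  case (3 x y xs)
  have *: "\<psi> x = [] \<or> (\<exists>c. \<psi> x = [c])" using 3(3)[of x] by (cases "\<psi> x") auto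
  show ?case
  proof (cases "x = y")
    case True
    then have "remdups_adj (concat (map \<psi> (x # y # xs))) = remdups_adj (concat (map \<psi> (y # xs)))"
      using * by auto
    then show ?thesis using 3 True by simp
  next
    case False
    then have "remdups_adj (concat (map \<psi> (y # xs))) = remdups_adj (concat (map \<psi> (remdups_adj (y # xs))))"
      using 3 by auto
    from remdups_adj_context_cong[OF this, of "\<psi> x" "[]"] show ?thesis using False by simp
  qed
qed auto

lemma distinct_remdups_adj_sorted: "sorted (xs :: nat list) \<Longrightarrow> distinct (remdups_adj xs)"
  by (induction xs rule: remdups_adj.induct) auto

text \<open>To find the type of the image of a long sorted list, it is enough to list in order the few entries
with nonempty image.\<close>

lemma remdups_adj_sorted_eval:
  fixes hs qs :: "nat list"
  assumes "sorted hs" "sorted_wrt (<) qs" "set qs \<subseteq> set hs"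
    and "\<And>h. h \<in> set hs \<Longrightarrow> h \<notin> set qs \<Longrightarrow> \<psi> h = []"
    and "\<And>h. h \<in> set qs \<Longrightarrow> length (\<psi> h) \<le> 1"
  shows "remdups_adj (concat (map \<psi> hs)) = remdups_adj (concat (map \<psi> qs))"
proof -
  let ?hs = "filter (\<lambda>h. h \<in> set qs) hs"
  have "concat (map \<psi> hs) = concat (map \<psi> ?hs)"
    using assms(4) by (induction hs) auto
  moreover have "remdups_adj ?hs = qs"
  proof (rule sorted_distinct_set_unique)
    have "sorted ?hs" using assms(1) by (rule sorted_wrt_filter)
    then show "sorted (remdups_adj ?hs)" by simp
    show "distinct (remdups_adj ?hs)" using \<open>sorted ?hs\<close> by (rule distinct_remdups_adj_sorted)
    show "sorted qs" "distinct qs" using assms(2) strict_sorted_iff by auto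
    show "set (remdups_adj ?hs) = set qs" using assms(3) by auto
  qed
  moreover have "remdups_adj (concat (map \<psi> ?hs)) = remdups_adj (concat (map \<psi> (remdups_adj ?hs)))"
    by (rule remdups_adj_concat_map) (use assms(5) in auto)
  ultimately show ?thesis by simp
qed

lemma map_eq_concat_split:
  assumes "map f ls = concat (map \<Theta> u)"
  shows "\<exists>Ss. length Ss = length u \<and> ls = concat Ss \<and> (\<forall>k<length u. map f (Ss ! k) = \<Theta> (u ! k))"
  using assms
proof (induction u arbitrary: ls)
  case (Cons t u)
  then obtain S ls' where ls: "ls = S @ ls'" "map f S = \<Theta> t" "map f ls' = concat (map \<Theta> u)"
    by (auto simp: map_eq_append_conv)
  from Cons.IH[OF ls(3)] obtain Ss where
    "length Ss = length u" "ls' = concat Ss" "\<forall>k<length u. map f (Ss ! k) = \<Theta> (u ! k)" by blast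
  then show ?case using ls
    by (intro exI[of _ "S # Ss"]) (auto simp: nth_Cons split: nat.splits)
qed auto

lemma sorted_concat_segment: "sorted (concat Ss) \<Longrightarrow> S \<in> set Ss \<Longrightarrow> sorted S"
  by (induction Ss) (auto simp: sorted_append)

lemma sorted_concat_nth:
  assumes "sorted (concat Ss)" "i < j" "j < length Ss" "x \<in> set (Ss ! i)" "y \<in> set (Ss ! j)"
  shows "x \<le> y"
  using assms
proof (induction Ss arbitrary: i j)
  case (Cons S Ss)
  then obtain j' where j: "j = Suc j'" by (cases j) auto
  show ?case
  proof (cases i)
    case 0
    then have "x \<in> set S" "y \<in> set (concat Ss)" using Cons j by auto
    then show ?thesis using Cons.prems by (auto simp: sorted_append)
  next
    case (Suc i')
    then show ?thesis using Cons j by (auto simp: sorted_append)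
  qed
qed auto

section \<open>Zigzag words\<close>

text \<open>The letter at place \<open>l\<close> of the zigzag: up through \<open>0, ..., m - 1\<close>, then the permutation \<open>\<tau>\<close>, then down.\<close>

definition letter_at :: "nat \<Rightarrow> (nat \<Rightarrow> nat) \<Rightarrow> nat \<Rightarrow> nat" where
  "letter_at m \<tau> l = (if l < m then l else if l < 2 * m then \<tau> (l - m) else 3 * m - 1 - l)"

text \<open>The number \<open>R\<close> bounds the letters of an identity. The last assumption provides more than \<open>R\<close>
different letters from the first to the middle place of \<open>j\<close>, and also from the middle to the last one: the letters \<open>j, ..., m - 1\<close> lie in both stretches, and if there are too few of them, then
the parts of \<open>\<tau>\<close> up to \<open>j\<close> and from \<open>j\<close> on are long enough.\<close>

locale zigzag =
  fixes m R :: nat and \<tau> \<pi> :: "nat \<Rightarrow> nat"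
  assumes tau: "q < m \<Longrightarrow> \<tau> q < m \<and> \<pi> (\<tau> q) = q"
    and pi: "j < m \<Longrightarrow> \<pi> j < m \<and> \<tau> (\<pi> j) = j"
    and step_neq: "Suc l < 3 * m \<Longrightarrow> letter_at m \<tau> l \<noteq> letter_at m \<tau> (Suc l)"
    and step_unique: "Suc l < 3 * m \<Longrightarrow> Suc l' < 3 * m \<Longrightarrow> letter_at m \<tau> l = letter_at m \<tau> l' \<Longrightarrow>
      letter_at m \<tau> (Suc l) = letter_at m \<tau> (Suc l') \<Longrightarrow> l = l'"
    and roomy: "j < m \<Longrightarrow> R < m - j \<or> R \<le> \<pi> j \<and> R < m - \<pi> j"
begin

abbreviation "\<gamma> \<equiv> letter_at m \<tau>"

definition follows_zigzag :: "word \<Rightarrow> bool" where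
  "follows_zigzag w \<longleftrightarrow> (\<exists>ls. sorted ls \<and> set ls = {..<3 * m} \<and> map \<gamma> ls = w)"

text \<open>Markers become the letters from \<open>m\<close> on, so that erasing them is filtering by \<open>z < m\<close>.\<close>

definition marked_letter :: "nat \<Rightarrow> nat" where
  "marked_letter h = (if even h then \<gamma> (h div 2) else m + h div 2)"

lemma gamma_less: "l < 3 * m \<Longrightarrow> \<gamma> l < m"
  using tau by (auto simp: letter_at_def)

lemma gamma_eq_iff:
  assumes "l < 3 * m" "j < m"
  shows "\<gamma> l = j \<longleftrightarrow> l = j \<or> l = m + \<pi> j \<or> l = 3 * m - 1 - j"
proof -
  consider "l < m" | "m \<le> l" "l < 2 * m" | "2 * m \<le> l" by linarith
  then show ?thesis
  proof cases
    case 1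
    then show ?thesis using assms by (auto simp: letter_at_def)
  next
    case 2
    then have "l - m < m" by simp
    from tau[OF this] pi[OF assms(2)] have "\<tau> (l - m) = j \<longleftrightarrow> l - m = \<pi> j" by auto
    then show ?thesis using 2 assms by (auto simp: letter_at_def)
  next
    case 3
    then show ?thesis using assms pi[of j] by (auto simp: letter_at_def)
  qed
qed

lemma marked_letter_half_labels_less:
  assumes "set S \<subseteq> {..<3 * m}"
  shows "filter (\<lambda>z. z < m) (map marked_letter (half_labels S)) = map \<gamma> S"
  using assms by (induction S rule: half_labels.induct) (auto simp: marked_letter_def gamma_less)

lemma marked_letter_half_labels_const:
  assumes "set S \<subseteq> {c}"
  shows "map marked_letter (half_labels S) = map \<gamma> S"
  using assms by (induction S rule: half_labels.induct) (auto simp: marked_letter_def)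

text \<open>The list of labels of \<open>\<Theta>(u)\<close> is cut into segments that belong to the occurrences of letters in \<open>u\<close>.
If a letter occurs more than once in \<open>u\<close>, its segments are constant: a step from \<open>l\<close> to \<open>Suc l\<close> in one of them would
have to recur in the other one, and by uniqueness of adjacent pairs it would be the same step, which
the sorted list makes only once. So inserting markers into all segments changes \<open>\<Theta>\<close> consistently.
A stretch of places without markers meets every segment in at most one place, and the segments of one
letter of \<open>u\<close> all in the same letter, so it has at most as many letters as \<open>u\<close>.\<close>

lemma insert_markers:
  assumes T: "type_faithful u v" and R: "card (set u) \<le> R"
    and Z: "follows_zigzag (concat (map \<Theta> u))"
  obtains hs C where "type_faithful (map marked_letter hs) C" "sorted_wrt half_before hs"
    "\<And>l. 2 * l \<in> set hs \<longleftrightarrow> l < 3 * m"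
    "\<And>a b. b < 3 * m \<Longrightarrow> R < card (\<gamma> ` {a..b}) \<Longrightarrow> \<exists>l. a \<le> l \<and> l < b \<and> 2 * l + 1 \<in> set hs"
    "filter (\<lambda>z. z < m) C = concat (map \<Theta> v)"
proof -
  obtain ls where ls: "sorted ls" "set ls = {..<3 * m}" "map \<gamma> ls = concat (map \<Theta> u)"
    using Z by (auto simp: follows_zigzag_def)
  obtain Ss where Ss: "length Ss = length u" "ls = concat Ss" 
    "\<And>k. k < length u \<Longrightarrow> map \<gamma> (Ss ! k) = \<Theta> (u ! k)"
    using map_eq_concat_split[OF ls(3)] by blast
  have sortedS: "sorted (Ss ! k)" if "k < length u" for k
    using ls(1) that Ss(1,2) by (simp add: sorted_concat_segment)
  have before: "a \<le> b" if "k < k'" "k' < length u" "a \<in> set (Ss ! k)" "b \<in> set (Ss ! k')" for k k' a b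
    using sorted_concat_nth[of Ss k k'] ls(1) Ss that by auto
  have seg_of: "\<exists>k<length u. l \<in> set (Ss ! k)" if "l < 3 * m" for l
  proof -
    have "l \<in> set (concat Ss)" using that ls(2) Ss(2) by simp
    then obtain S where "S \<in> set Ss" "l \<in> set S" by auto
    then show ?thesis using Ss(1) by (metis in_set_conv_nth)
  qed
  have sub: "set (Ss ! k) \<subseteq> {..<3 * m}" if "k < length u" for k
  proof -
    have "Ss ! k \<in> set Ss" using that Ss(1) by simp
    then have "set (Ss ! k) \<subseteq> set ls" using Ss(2) by auto
    then show ?thesis using ls(2) by simp
  qed
  have contig: "l \<in> set (Ss ! k)"
    if k: "k < length u" and "a \<in> set (Ss ! k)" "b \<in> set (Ss ! k)" "a \<le> l" "l \<le> b" for k a b l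
  proof -
    have "l < 3 * m" using sub[OF k] that by auto
    then obtain k' where k': "k' < length u" "l \<in> set (Ss ! k')" using seg_of by blast
    consider "k < k'" | "k = k'" | "k' < k" by linarith
    then show ?thesis
    proof cases
      case 1
      then have "b \<le> l" using before k' that by blast
      then show ?thesis using that by simp
    next
      case 3
      then have "l \<le> a" using before k' that by blast
      then show ?thesis using that by simp
    qed (use k' in simp)
  qed
  have step: "Ss ! k ! Suc q \<le> Suc (Ss ! k ! q)"
    if "k < length u" "Suc q < length (Ss ! k)" for k q
  proof (rule ccontr)
    let ?S = "Ss ! k"
    assume "\<not> ?thesis"
    then have lt: "Suc (?S ! q) < ?S ! Suc q" by simp
    then have "Suc (?S ! q) \<in> set ?S"
      using contig[OF that(1), of "?S ! q" "?S ! Suc q" "Suc (?S ! q)"] that by simp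
    then obtain p where p: "p < length ?S" "?S ! p = Suc (?S ! q)" by (auto simp: in_set_conv_nth)
    show False
    proof (cases "p \<le> q")
      case True
      then have "?S ! p \<le> ?S ! q" using sortedS[OF that(1)] that(2) by (simp add: sorted_nth_mono)
      then show False using p by simp
    next
      case False
      then have "?S ! Suc q \<le> ?S ! p" using sortedS[OF that(1)] p sorted_nth_mono[of ?S "Suc q" p] by simp
      then show False using p lt by simp
    qed
  qed
  \<comment> \<open>A step inside a segment whose letter occurs again in \<open>u\<close> would be repeated there.\<close>
  have const: "a = b"
    if "k < length u" "k' < length u" "k \<noteq> k'" "u ! k = u ! k'" "a \<in> set (Ss ! k)" "b \<in> set (Ss ! k)" for k k' a b
  proof -
    have "\<not> a < b" if a: "a \<in> set (Ss ! k)" and b: "b \<in> set (Ss ! k)" for a b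
    proof
      assume "a < b"
      let ?S = "Ss ! k" and ?S' = "Ss ! k'"
      have "\<exists>q. Suc q < length ?S \<and> ?S ! q < ?S ! Suc q"
      proof (rule ccontr)
        assume no: "\<not> ?thesis"
        have "?S ! q = ?S ! 0" if "q < length ?S" for q
          using that
        proof (induction q)
          case (Suc q)
          then have "\<not> ?S ! q < ?S ! Suc q" using no by blast
          moreover have "?S ! q \<le> ?S ! Suc q" 
            using sortedS[OF \<open>k < length u\<close>] Suc.prems by (simp add: sorted_nth_mono)
          ultimately show ?case using Suc by simp
        qed simp
        then have "x = ?S ! 0" if "x \<in> set ?S" for x using that by (auto simp: in_set_conv_nth)
        then show False using a b \<open>a < b\<close> by blast
      qed
      then obtain q where q: "Suc q < length ?S" "?S ! q < ?S ! Suc q" by blast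
      have q1: "?S ! Suc q = Suc (?S ! q)" using q step[OF \<open>k < length u\<close> q(1)] by simp
      have eq: "map \<gamma> ?S = map \<gamma> ?S'" using Ss(3) that \<open>k < length u\<close> \<open>k' < length u\<close> \<open>u ! k = u ! k'\<close> by metis
      then have len: "length ?S = length ?S'" by (metis length_map)
      have g: "\<gamma> (?S ! p) = \<gamma> (?S' ! p)" if "p < length ?S" for p
        using eq that len by (metis nth_map)
      have lt: "?S ! Suc q < 3 * m" "?S' ! Suc q < 3 * m"
        using sub[OF \<open>k < length u\<close>] sub[OF \<open>k' < length u\<close>] q len by (auto simp: subset_iff)
      have "\<gamma> (?S ! q) \<noteq> \<gamma> (?S ! Suc q)" using step_neq[of "?S ! q"] lt q1 by simp
      then have "?S' ! q \<noteq> ?S' ! Suc q" using g[of q] g[of "Suc q"] q by auto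
      moreover have "?S' ! q \<le> ?S' ! Suc q"
        using sortedS[OF \<open>k' < length u\<close>] q(1) len by (simp add: sorted_nth_mono)
      ultimately have q2: "?S' ! Suc q = Suc (?S' ! q)"
        using step[OF \<open>k' < length u\<close>, of q] q(1) len by simp
      have "?S ! q = ?S' ! q"
      proof (rule step_unique)
        show "\<gamma> (?S ! q) = \<gamma> (?S' ! q)" using g q by simp
        show "\<gamma> (Suc (?S ! q)) = \<gamma> (Suc (?S' ! q))" using g[OF q(1)] q1 q2 by simp
      qed (use lt q1 q2 in auto)
      moreover have mem: "?S ! q \<in> set ?S" "?S ! Suc q \<in> set ?S" "?S' ! q \<in> set ?S'" "?S' ! Suc q \<in> set ?S'"
        using q len by auto
      ultimately show False
        using before[of k k' "?S ! Suc q" "?S' ! q"] before[of k' k "?S' ! Suc q" "?S ! q"]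
          \<open>k < length u\<close> \<open>k' < length u\<close> \<open>k \<noteq> k'\<close> q1 q2 by linarith
    qed
    from this[OF that(5,6)] this[OF that(6,5)] show ?thesis by simp
  qed
  define hs where "hs = concat (map half_labels Ss)"
  define pos where "pos t = (SOME k. k < length u \<and> u ! k = t)" for t
  define \<Theta>' where "\<Theta>' t = (if t \<in> set u then map marked_letter (half_labels (Ss ! pos t)) else \<Theta> t)" for t
  have pos: "pos t < length u" "u ! pos t = t" if "t \<in> set u" for t
    using someI_ex[of "\<lambda>k. k < length u \<and> u ! k = t"] that by (auto simp: pos_def in_set_conv_nth)
  have \<Theta>': "\<Theta>' (u ! k) = map marked_letter (half_labels (Ss ! k))" if k: "k < length u" for k
  proof (cases "pos (u ! k) = k")
    case True
    then show ?thesis using k by (simp add: \<Theta>'_def)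
  next
    case False
    have *: "map marked_letter (half_labels (Ss ! k)) = \<Theta> (u ! k)"
      if "k < length u" "k' < length u" "k \<noteq> k'" "u ! k = u ! k'" for k k'
    proof -
      have "set (Ss ! k) \<subseteq> {hd (Ss ! k)}"
      proof
        fix a assume a: "a \<in> set (Ss ! k)"
        then have "hd (Ss ! k) \<in> set (Ss ! k)" by (cases "Ss ! k") auto
        from const[OF that a this] show "a \<in> {hd (Ss ! k)}" by simp
      qed
      then show ?thesis using marked_letter_half_labels_const Ss(3)[OF that(1)] by simp
    qed
    have u: "u ! k \<in> set u" using k by simp
    have "\<Theta>' (u ! k) = map marked_letter (half_labels (Ss ! pos (u ! k)))" using u by (simp add: \<Theta>'_def)
    also have "\<dots> = \<Theta> (u ! k)"
      using *[OF pos(1)[OF u] k False pos(2)[OF u]] by (simp only: pos(2)[OF u])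
    also have "\<dots> = map marked_letter (half_labels (Ss ! k))"
      using *[OF k pos(1)[OF u] False[symmetric] pos(2)[OF u, symmetric]] by simp
    finally show ?thesis .
  qed
  have "map \<Theta>' u = map (\<lambda>S. map marked_letter (half_labels S)) Ss"
  proof (rule nth_equalityI)
    fix k assume "k < length (map \<Theta>' u)"
    then have "k < length u" by simp
    from \<Theta>'[OF this] show "map \<Theta>' u ! k = map (\<lambda>S. map marked_letter (half_labels S)) Ss ! k"
      using \<open>k < length u\<close> Ss(1) by simp
  qed (simp add: Ss(1))
  then have C: "concat (map \<Theta>' u) = map marked_letter hs" by (simp add: hs_def map_concat o_def)
  have erase: "filter (\<lambda>z. z < m) (\<Theta>' t) = \<Theta> t" if "t \<in> set u" for t
  proof -
    have "filter (\<lambda>z. z < m) (\<Theta>' t) = map \<gamma> (Ss ! pos t)"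
      using marked_letter_half_labels_less[OF sub[OF pos(1)[OF that]]] that by (simp add: \<Theta>'_def)
    then show ?thesis using Ss(3)[OF pos(1)[OF that]] by (simp only: pos(2)[OF that])
  qed
  show thesis
  proof (rule that)
    show "type_faithful (map marked_letter hs) (concat (map \<Theta>' v))"
      using type_faithful_subst[OF T, of \<Theta>'] C by simp
    show "sorted_wrt half_before hs" using sorted_half_labels_concat ls(1) Ss(2) by (simp add: hs_def)
    have "2 * l \<in> set hs \<longleftrightarrow> l \<in> set ls" for l
    proof
      assume "2 * l \<in> set hs"
      then obtain S where "S \<in> set Ss" "2 * l \<in> set (half_labels S)" by (auto simp: hs_def)
      from this(2) have "l \<in> set S" by (rule half_labelsE) (auto, presburger)
      then show "l \<in> set ls" using \<open>S \<in> set Ss\<close> Ss(2) by auto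
    next
      assume "l \<in> set ls"
      then obtain S where "S \<in> set Ss" "l \<in> set S" using Ss(2) by auto
      then show "2 * l \<in> set hs" using even_half_labels by (auto simp: hs_def)
    qed
    then show "2 * l \<in> set hs \<longleftrightarrow> l < 3 * m" for l by (simp only: ls(2) lessThan_iff)
    show "filter (\<lambda>z. z < m) (concat (map \<Theta>' v)) = concat (map \<Theta> v)"
    proof -
      have A: "map (\<lambda>t. filter (\<lambda>z. z < m) (\<Theta>' t)) v = map \<Theta> v"
      proof (rule map_cong[OF HOL.refl])
        fix t assume "t \<in> set v"
        then show "filter (\<lambda>z. z < m) (\<Theta>' t) = \<Theta> t" using type_faithful_set[OF T] by (intro erase) simp
      qed
      have B: "filter (\<lambda>z. z < m) (concat (map \<Theta>' w)) = concat (map (\<lambda>t. filter (\<lambda>z. z < m) (\<Theta>' t)) w)" for w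
        by (induction w) auto
      show ?thesis by (simp only: A B)
    qed
    show "\<exists>l. a \<le> l \<and> l < b \<and> 2 * l + 1 \<in> set hs" if b: "b < 3 * m" and many: "R < card (\<gamma> ` {a..b})" for a b
    proof (rule ccontr)
      assume no: "\<not> ?thesis"
      \<comment> \<open>Two places in one segment would have a marker between them.\<close>
      have apart: "l = l'" if "k < length u" "l \<in> set (Ss ! k)" "l' \<in> set (Ss ! k)" "l \<in> {a..b}" "l' \<in> {a..b}" for k l l'
      proof -
        have "\<not> l < l'" if "l \<in> set (Ss ! k)" "l' \<in> set (Ss ! k)" "l \<in> {a..b}" "l' \<in> {a..b}" for l l'
        proof
          assume "l < l'"
          then have "Suc l \<in> set (Ss ! k)" using contig[OF \<open>k < length u\<close> that(1,2), of "Suc l"] by simp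
          then have "2 * l + 1 \<in> set (half_labels (Ss ! k))"
            using odd_half_labels[OF sortedS[OF \<open>k < length u\<close>] that(1)] by simp
          moreover have "Ss ! k \<in> set Ss" using \<open>k < length u\<close> Ss(1) by simp
          ultimately have "2 * l + 1 \<in> set hs" unfolding hs_def set_concat set_map by blast
          moreover have "a \<le> l" "l < b" using that(3,4) \<open>l < l'\<close> by auto
          ultimately show False using no by blast
        qed
        from this[OF that(2-5)] this[OF that(3,2,5,4)] show ?thesis by simp
      qed
      define lies where "lies c l k \<longleftrightarrow> l \<in> {a..b} \<and> \<gamma> l = c \<and> k < length u \<and> l \<in> set (Ss ! k)" for c l k
      have "\<exists>l k. lies c l k" if "c \<in> \<gamma> ` {a..b}" for c
      proof -
        from that obtain l where "l \<in> {a..b}" "\<gamma> l = c" by auto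
        then show ?thesis using seg_of[of l] b unfolding lies_def by auto
      qed
      then obtain lab seg where "\<And>c. c \<in> \<gamma> ` {a..b} \<Longrightarrow> lies c (lab c) (seg c)" by metis
      then have lab: "lab c \<in> {a..b} \<and> \<gamma> (lab c) = c \<and> seg c < length u \<and> lab c \<in> set (Ss ! seg c)"
        if "c \<in> \<gamma> ` {a..b}" for c using that unfolding lies_def by blast
      have "inj_on (\<lambda>c. u ! seg c) (\<gamma> ` {a..b})"
      proof (rule inj_onI)
        fix c d assume c: "c \<in> \<gamma> ` {a..b}" and d: "d \<in> \<gamma> ` {a..b}" and eq: "u ! seg c = u ! seg d"
        show "c = d"
        proof (cases "seg c = seg d")
          case True
          then have "lab d \<in> set (Ss ! seg c)" using lab[OF d] by (simp only:)
          then have "lab c = lab d" using lab[OF c] lab[OF d] by (intro apart[of "seg c"]) blast+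
          then show ?thesis using lab[OF c] lab[OF d] by metis
        next
          case False
          have "map \<gamma> (Ss ! seg c) = map \<gamma> (Ss ! seg d)"
            using Ss(3)[of "seg c"] Ss(3)[of "seg d"] lab[OF c] lab[OF d] eq by argo
          then have "\<gamma> ` set (Ss ! seg c) = \<gamma> ` set (Ss ! seg d)" by (metis set_map)
          moreover have "\<gamma> (lab d) \<in> \<gamma> ` set (Ss ! seg d)" using lab[OF d] by blast
          ultimately have "\<gamma> (lab d) \<in> \<gamma> ` set (Ss ! seg c)" by simp
          then obtain l where l: "l \<in> set (Ss ! seg c)" "\<gamma> l = \<gamma> (lab d)" by auto
          have "l = lab c" using const[OF _ _ False eq l(1)] lab[OF c] lab[OF d] by blast
          then show ?thesis using l(2) lab[OF c] lab[OF d] by argo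
        qed
      qed
      then have "card (\<gamma> ` {a..b}) \<le> card (set u)"
      proof (rule card_inj_on_le)
        show "(\<lambda>c. u ! seg c) ` \<gamma> ` {a..b} \<subseteq> set u"
        proof
          fix t assume "t \<in> (\<lambda>c. u ! seg c) ` \<gamma> ` {a..b}"
          then obtain c where c: "c \<in> \<gamma> ` {a..b}" "t = u ! seg c" by blast
          then show "t \<in> set u" using lab[OF c(1)] by simp
        qed
      qed simp
      then show False using many R by simp
    qed
  qed
qed

end

lemma count_list_replicate_eq: "count_list (replicate k a) b = (if a = b then k else 0)"
  by (induction k) auto

section \<open>Words with five islands\<close>

definition five_islands :: "nat \<Rightarrow> nat \<Rightarrow> nat \<Rightarrow> nat \<Rightarrow> nat \<Rightarrow> nat \<Rightarrow> nat \<Rightarrow> word" where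
  "five_islands i j e1 f1 e2 f2 e3 =
     replicate e1 i @ replicate f1 j @ replicate e2 i @ replicate f2 j @ replicate e3 i"

text \<open>The numbers of \<open>i\<close> and \<open>j\<close> before an occurrence tell in which island it lies.\<close>

lemma five_islands_prefix:
  assumes eq: "P @ x # S = five_islands i j e1 f1 e2 f2 e3" and ij: "i \<noteq> j"
  shows "x = i \<and> (count_list P i < e1 \<and> count_list P j = 0 \<or>
                  e1 \<le> count_list P i \<and> count_list P i < e1 + e2 \<and> count_list P j = f1 \<or>
                  e1 + e2 \<le> count_list P i \<and> count_list P j = f1 + f2) \<or>
         x = j \<and> (count_list P i = e1 \<and> count_list P j < f1 \<or>
                  count_list P i = e1 + e2 \<and> f1 \<le> count_list P j \<and> count_list P j < f1 + f2)"
proof -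
  let ?W = "five_islands i j e1 f1 e2 f2 e3"
  define p where "p = length P"
  have P: "P = take p ?W" and x: "x = ?W ! p" and p: "p < length ?W"
    unfolding eq[symmetric] p_def by auto
  have ci: "count_list P i = min p e1 + min (p - e1 - f1) e2 + min (p - e1 - f1 - e2 - f2) e3"
    and cj: "count_list P j = min (p - e1) f1 + min (p - e1 - f1 - e2) f2"
    unfolding P five_islands_def using ij
    by (auto simp: count_list_replicate_eq take_append min_def)
  have x': "x = (if p < e1 then i else if p < e1 + f1 then j else if p < e1 + f1 + e2 then i
      else if p < e1 + f1 + e2 + f2 then j else i)"
    unfolding x five_islands_def using p by (auto simp: nth_append five_islands_def)
  have p': "p < e1 + f1 + e2 + f2 + e3" using p by (simp add: five_islands_def)
  show ?thesis
    unfolding x' ci cj using ij p' by (auto simp: min_def)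
qed

lemma remdups_adj_insert_inside:
  assumes "a \<noteq> b"
  shows "length (remdups_adj (xs @ [a] @ [b] @ [a] @ ys)) = length (remdups_adj (xs @ [a] @ [a] @ ys)) + 2"
proof -
  have "remdups_adj (xs @ a # z) = remdups_adj (xs @ [a]) @ tl (remdups_adj (a # z))" for z
    by (rule remdups_adj_append)
  from this[of "b # a # ys"] this[of "a # ys"] show ?thesis
    using assms by (simp add: remdups_adj_Cons')
qed

text \<open>A letter \<open>j\<close> dropped into the interior of an island of \<open>i\<close> creates two more islands. If it creates none,
then every island of \<open>i\<close> lies on one side of the cut, and the number of letters \<open>i\<close> before the cut is a
partial sum of the exponents. The same holds with \<open>i\<close> and \<open>j\<close> exchanged.\<close>

lemma five_islands_insert:
  assumes eq: "V @ Z = five_islands i j e1 f1 e2 f2 e3" and ij: "i \<noteq> j"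
    and five: "length (remdups_adj (five_islands i j e1 f1 e2 f2 e3)) = 5"
    and le: "length (remdups_adj (V @ [b] @ Z)) \<le> 5"
  shows "b = j \<Longrightarrow> count_list V i = 0 \<or> count_list V i = e1 \<or> count_list V i = e1 + e2 \<or> 
           count_list Z i = 0"
    and "b = i \<Longrightarrow> count_list V j = 0 \<or> count_list V j = f1 \<or> count_list Z j = 0"
proof -
  have inside: "\<not> (last V = a \<and> hd Z = a)" if "V \<noteq> []" "Z \<noteq> []" "a \<noteq> b" for a
  proof
    assume "last V = a \<and> hd Z = a"
    then obtain V' Z' where V: "V = V' @ [a]" and Z: "Z = a # Z'"
      using \<open>V \<noteq> []\<close> \<open>Z \<noteq> []\<close> by (metis append_butlast_last_id list.collapse)
    have "length (remdups_adj (V @ [b] @ Z)) = length (remdups_adj (V @ Z)) + 2"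
      using remdups_adj_insert_inside[OF \<open>a \<noteq> b\<close>, of V' Z'] by (simp add: V Z)
    then show False using le five eq by simp
  qed
  have total: "count_list V c + count_list Z c = count_list (five_islands i j e1 f1 e2 f2 e3) c" for c
    unfolding eq[symmetric] by simp
  show "count_list V i = 0 \<or> count_list V i = e1 \<or> count_list V i = e1 + e2 \<or> count_list Z i = 0" if b: "b = j"
  proof (cases "V = [] \<or> Z = []")
    case False
    then obtain V' y x Z' where VZ: "V = V' @ [y]" "Z = x # Z'"
      by (metis append_butlast_last_id list.collapse)
    have "x \<noteq> i \<or> y \<noteq> i" using inside[of i] False b ij VZ by auto
    moreover note five_islands_prefix[OF _ ij, of V x Z' e1 f1 e2 f2 e3]
      five_islands_prefix[OF _ ij, of V' y "x # Z'" e1 f1 e2 f2 e3]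
    ultimately show ?thesis using eq ij VZ by auto
  qed auto
  show "count_list V j = 0 \<or> count_list V j = f1 \<or> count_list Z j = 0" if b: "b = i"
  proof (cases "V = [] \<or> Z = []")
    case False
    then obtain V' y x Z' where VZ: "V = V' @ [y]" "Z = x # Z'"
      by (metis append_butlast_last_id list.collapse)
    have 1: "x \<noteq> j \<or> y \<noteq> j" using inside[of j] False b ij VZ by auto
    have "count_list (five_islands i j e1 f1 e2 f2 e3) j = f1 + f2"
      using ij by (simp add: five_islands_def count_list_replicate_eq)
    then have "count_list Z j = 0 \<longleftrightarrow> count_list V j = f1 + f2" using total[of j] by auto
    moreover note five_islands_prefix[OF _ ij, of V x Z' e1 f1 e2 f2 e3]
      five_islands_prefix[OF _ ij, of V' y "x # Z'" e1 f1 e2 f2 e3]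
    ultimately show ?thesis using eq ij VZ 1 by auto
  qed auto
qed

lemma count_list_filter: "count_list (filter P xs) x = (if P x then count_list xs x else 0)"
  by (induction xs) auto

lemma concat_map_singleton_if: "concat (map (\<lambda>z. if P z then [z] else []) xs) = filter P xs"
  by (induction xs) auto

section \<open>The markers cut islands at their borders\<close>

lemma count_list_nth_witness:
  assumes "c < count_list B x"
  obtains k where "k < length B" "B ! k = x" "count_list (take k B) x = c"
proof -
  have "\<exists>k<length B. B ! k = x \<and> count_list (take k B) x = c"
    using assms
  proof (induction B arbitrary: c)
    case (Cons b B)
    show ?case
    proof (cases "b = x \<and> c = 0")
      case True
      then show ?thesis by (intro exI[of _ 0]) auto
    next
      case False
      then have "(if b = x then c - 1 else c) < count_list B x" using Cons.prems by (auto split: if_splits)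
      from Cons.IH[OF this] obtain k where
        "k < length B" "B ! k = x" "count_list (take k B) x = (if b = x then c - 1 else c)" by blast
      then show ?thesis using False by (intro exI[of _ "Suc k"]) auto
    qed
  qed auto
  then show thesis using that by blast
qed

lemma count_list_take_less:
  assumes "k < k'" "k' \<le> length B"
  shows "count_list (take k B) (B ! k) < count_list (take k' B) (B ! k)"
    and "count_list (take k B) x \<le> count_list (take k' B) x"
proof -
  have "take k' B = take k B @ B ! k # take (k' - Suc k) (drop (Suc k) B)"
    using assms by (metis Cons_nth_drop_Suc Suc_diff_Suc diff_Suc_Suc le_add_diff_inverse less_imp_le less_le_trans take_Suc_Cons take_add)
  then show "count_list (take k B) (B ! k) < count_list (take k' B) (B ! k)"
    "count_list (take k B) x \<le> count_list (take k' B) x" by simp_all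
qed

text \<open>The outcome of \<open>insert_markers\<close>: the half-labels \<open>hs\<close> of the marked zigzag word and the word \<open>C\<close> which
is the other side of the marked identity.\<close>

locale marked_zigzag = zigzag +
  fixes hs C
  assumes faithful: "type_faithful (map marked_letter hs) C"
    and sorted_hs: "sorted_wrt half_before hs"
    and even_hs: "2 * l \<in> set hs \<longleftrightarrow> l < 3 * m"
    and window_hs: "b < 3 * m \<Longrightarrow> R < card (\<gamma> ` {a..b}) \<Longrightarrow> \<exists>l. a \<le> l \<and> l < b \<and> Suc (2 * l) \<in> set hs"
begin

definition mid_label :: "nat \<Rightarrow> nat" where "mid_label j = m + \<pi> j"
definition last_label :: "nat \<Rightarrow> nat" where "last_label j = 3 * m - 1 - j"

lemma label_bounds:
  "j < m \<Longrightarrow> m \<le> mid_label j" "j < m \<Longrightarrow> mid_label j < 2 * m"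
  "j < m \<Longrightarrow> 2 * m \<le> last_label j" "j < m \<Longrightarrow> last_label j < 3 * m"
  using pi[of j] by (auto simp: mid_label_def last_label_def)

lemma last_label_less: "i < j \<Longrightarrow> j < m \<Longrightarrow> last_label j < last_label i"
  by (auto simp: last_label_def)

lemma gamma_eq_label:
  "l < 3 * m \<Longrightarrow> j < m \<Longrightarrow> \<gamma> l = j \<longleftrightarrow> l = j \<or> l = mid_label j \<or> l = last_label j"
  unfolding mid_label_def last_label_def by (rule gamma_eq_iff)

lemma marked_letter_eq_letter:
  assumes "h \<in> set hs" "j < m"
  shows "marked_letter h = j \<longleftrightarrow> h = 2 * j \<or> h = 2 * (mid_label j) \<or> h = 2 * (last_label j)"
proof (cases "even h")
  case True
  then obtain l where l: "h = 2 * l" by auto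
  then have "l < 3 * m" using assms even_hs by simp
  then show ?thesis using gamma_eq_label[of l j] assms(2) by (simp add: l marked_letter_def)
next
  case False
  then have "h \<noteq> 2 * x" for x by auto
  then show ?thesis using False assms(2) by (auto simp: marked_letter_def)
qed

lemma marked_letter_eq_marker:
  assumes "h \<in> set hs"
  shows "marked_letter h = m + l \<longleftrightarrow> h = Suc (2 * l)"
proof (cases "even h")
  case True
  then obtain l' where l: "h = 2 * l'" by auto
  then have "l' < 3 * m" using assms even_hs by simp
  then have "\<gamma> l' < m" by (rule gamma_less)
  moreover have "2 * l' \<noteq> Suc (2 * l)" by presburger
  ultimately show ?thesis by (simp add: l marked_letter_def)
next
  case False
  then obtain l' where l: "h = Suc (2 * l')" by (auto elim: oddE)
  then show ?thesis by (simp add: marked_letter_def)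
qed

lemma marked_letter_simps:
  "j < m \<Longrightarrow> marked_letter (2 * j) = j"
  "j < m \<Longrightarrow> marked_letter (2 * (mid_label j)) = j"
  "j < m \<Longrightarrow> marked_letter (2 * (last_label j)) = j"
  "marked_letter (Suc (2 * l)) = m + l"
  using gamma_eq_label[of j j] gamma_eq_label[of "mid_label j" j] gamma_eq_label[of "last_label j" j]
    label_bounds[of j] by (auto simp: marked_letter_def)

lemma occurrence_in_hs:
  "j < m \<Longrightarrow> 2 * j \<in> set hs" "j < m \<Longrightarrow> 2 * (mid_label j) \<in> set hs" "j < m \<Longrightarrow> 2 * (last_label j) \<in> set hs"
  using even_hs label_bounds[of j] by auto

text \<open>The only way in which information passes from the zigzag to \<open>C\<close>: the type of \<open>\<phi>(C)\<close> is read off from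
the half-labels \<open>qs\<close> that \<open>\<phi>\<close> does not delete.\<close>

lemma type_of_C:
  fixes \<phi> :: "nat \<Rightarrow> word"
  assumes "sorted_wrt (<) qs" "set qs \<subseteq> set hs" 
    "\<And>h. h \<in> set hs \<Longrightarrow> \<phi> (marked_letter h) \<noteq> [] \<Longrightarrow> h \<in> set qs"
    "\<And>z. set (\<phi> z) \<subseteq> {x, y}" "\<And>z. length (\<phi> z) \<le> 1"
    "remdups_adj (concat (map \<phi> (map marked_letter qs))) = t" "length t \<le> 5"
  shows "remdups_adj (concat (map \<phi> C)) = t"
proof (rule type_faithfulD[OF faithful assms(4) _ assms(7)])
  have "remdups_adj (concat (map (\<lambda>h. \<phi> (marked_letter h)) hs)) =
    remdups_adj (concat (map (\<lambda>h. \<phi> (marked_letter h)) qs))"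
    by (rule remdups_adj_sorted_eval)
      (use assms(1-3,5) half_before_sorted[OF sorted_hs] in auto)
  then show "remdups_adj (concat (map \<phi> (map marked_letter hs))) = t"
    using assms(6) by (simp add: o_def)
qed

text \<open>The two markers are meant to separate the first, the middle and the last occurrences of \<open>j\<close>. Only the
numbers \<open>a\<close> and \<open>b\<close> of occurrences are kept: they survive when letters are deleted, so the cuts of all
letters can be compared in the words over pairs of letters.\<close>

definition cuts :: "nat \<Rightarrow> nat \<Rightarrow> nat \<Rightarrow> bool" where
  "cuts j a b \<longleftrightarrow> (\<exists>l l' X Y Z. j \<le> l \<and> l < mid_label j \<and> mid_label j \<le> l' \<and> l' < last_label j \<and>
     Suc (2 * l) \<in> set hs \<and> Suc (2 * l') \<in> set hs \<and>
     C = X @ (m + l) # Y @ (m + l') # Z \<and>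
     m + l \<notin> set (X @ Y @ Z) \<and> m + l' \<notin> set (X @ Y @ Z) \<and>
     a = count_list X j \<and> b = count_list (X @ Y) j \<and> 0 < a \<and> a < b \<and> b < count_list C j)"

lemma marker_once:
  assumes "Suc (2 * l) \<in> set hs"
  shows "count_list C (m + l) = 1"
proof (rule type_faithful_linear[OF faithful])
  have "count_list (map marked_letter hs) (m + l) = count_list hs (Suc (2 * l))"
  proof -
    have "set hs' \<subseteq> set hs \<Longrightarrow> count_list (map marked_letter hs') (m + l) = count_list hs' (Suc (2 * l))" for hs'
      by (induction hs') (use marked_letter_eq_marker in auto)
    then show ?thesis by simp
  qed
  then show "count_list (map marked_letter hs) (m + l) = 1"
    using half_before_count_odd[OF sorted_hs] assms by simp
qed

lemma count_list_one_split:
  assumes "count_list xs s = 1"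
  obtains X Y where "xs = X @ s # Y" "s \<notin> set X" "s \<notin> set Y"
proof -
  have "s \<in> set xs" using assms by (metis count_notin zero_neq_one)
  then obtain X Y where "xs = X @ s # Y" "s \<notin> set X" by (meson split_list_first)
  then show thesis using assms that[of X Y] by (simp add: count_list_0_iff)
qed

lemma markers_in_order:
  assumes l: "Suc (2 * l) \<in> set hs" "Suc (2 * l') \<in> set hs" "l < l'"
  obtains X Y Z where "C = X @ (m + l) # Y @ (m + l') # Z"
    "m + l \<notin> set (X @ Y @ Z)" "m + l' \<notin> set (X @ Y @ Z)"
proof -
  obtain X W where XW: "C = X @ (m + l) # W" "m + l \<notin> set X" "m + l \<notin> set W"
    using count_list_one_split[OF marker_once[OF l(1)]] by blast
  have cnt: "count_list X (m + l') + count_list W (m + l') = 1"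
    using marker_once[OF l(2)] l(3) unfolding XW by simp
  let ?P = "\<lambda>z. z = m + l \<or> z = m + l'"
  let ?\<phi> = "\<lambda>z. if ?P z then [z] else []"
  have "remdups_adj (concat (map ?\<phi> C)) = [m + l, m + l']"
    by (rule type_of_C[where qs = "[Suc (2 * l), Suc (2 * l')]" and x = "m + l" and y = "m + l'"])
      (use l in \<open>auto simp: marked_letter_eq_marker marked_letter_simps split: if_splits\<close>)
  then have type: "remdups_adj (filter ?P C) = [m + l, m + l']" by (simp add: concat_map_singleton_if)
  have "m + l' \<notin> set X"
  proof
    assume "m + l' \<in> set X"
    then have "filter ?P X \<noteq> []" by (auto simp: filter_empty_conv)
    then have "hd (filter ?P C) = hd (filter ?P X)" "hd (filter ?P X) \<in> set (filter ?P X)"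
      unfolding XW by (auto simp del: set_filter)
    then have "hd (filter ?P C) \<noteq> m + l" using XW(2) by auto
    moreover have "hd (filter ?P C) = m + l" using type hd_remdups_adj[of "filter ?P C"] by simp
    ultimately show False by simp
  qed
  then have "count_list W (m + l') = 1" using cnt by (simp add: count_list_0_iff)
  then obtain Y Z where "W = Y @ (m + l') # Z" "m + l' \<notin> set Y" "m + l' \<notin> set Z"
    by (rule count_list_one_split)
  then show thesis using that[of X Y Z] XW \<open>m + l' \<notin> set X\<close> by auto
qed

lemma interval_letters:
  "j < m \<Longrightarrow> {j..<m} \<subseteq> \<gamma> ` {j..mid_label j}"
  "j < m \<Longrightarrow> \<tau> ` {0..\<pi> j} \<subseteq> \<gamma> ` {j..mid_label j}"
  "j < m \<Longrightarrow> {j..<m} \<subseteq> \<gamma> ` {mid_label j..last_label j}"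
  "j < m \<Longrightarrow> \<tau> ` {\<pi> j..<m} \<subseteq> \<gamma> ` {mid_label j..last_label j}"
proof -
  assume j: "j < m"
  note pij = pi[OF j]
  show "{j..<m} \<subseteq> \<gamma> ` {j..mid_label j}"
  proof
    fix c assume "c \<in> {j..<m}"
    then show "c \<in> \<gamma> ` {j..mid_label j}" by (intro image_eqI[of _ _ c]) (auto simp: letter_at_def mid_label_def last_label_def)
  qed
  show "\<tau> ` {0..\<pi> j} \<subseteq> \<gamma> ` {j..mid_label j}"
  proof
    fix c assume "c \<in> \<tau> ` {0..\<pi> j}"
    then obtain q where "q \<le> \<pi> j" "c = \<tau> q" by auto
    then show "c \<in> \<gamma> ` {j..mid_label j}" using j pij by (intro image_eqI[of _ _ "m + q"]) (auto simp: letter_at_def mid_label_def last_label_def)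
  qed
  show "{j..<m} \<subseteq> \<gamma> ` {mid_label j..last_label j}"
  proof
    fix c assume "c \<in> {j..<m}"
    then show "c \<in> \<gamma> ` {mid_label j..last_label j}" using pij 
      by (intro image_eqI[of _ _ "3 * m - 1 - c"]) (auto simp: letter_at_def mid_label_def last_label_def)
  qed
  show "\<tau> ` {\<pi> j..<m} \<subseteq> \<gamma> ` {mid_label j..last_label j}"
  proof
    fix c assume "c \<in> \<tau> ` {\<pi> j..<m}"
    then obtain q where "\<pi> j \<le> q" "q < m" "c = \<tau> q" by auto
    then show "c \<in> \<gamma> ` {mid_label j..last_label j}" using j pij by (intro image_eqI[of _ _ "m + q"]) (auto simp: letter_at_def mid_label_def last_label_def)
  qed
qed

lemma inj_tau: "inj_on \<tau> {..<m}"
  by (rule inj_on_inverseI[of _ \<pi>]) (use tau in auto)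

lemma markers_exist:
  assumes j: "j < m"
  shows "\<exists>l. j \<le> l \<and> l < mid_label j \<and> Suc (2 * l) \<in> set hs"
    "\<exists>l. mid_label j \<le> l \<and> l < last_label j \<and> Suc (2 * l) \<in> set hs"
proof -
  have inj: "inj_on \<tau> {0..\<pi> j}" "inj_on \<tau> {\<pi> j..<m}"
    using inj_on_subset[OF inj_tau] pi[OF j] by (auto simp: subset_iff)
  have card1: "m - j \<le> card (\<gamma> ` {j..mid_label j})" "Suc (\<pi> j) \<le> card (\<gamma> ` {j..mid_label j})"
    using card_mono[OF _ interval_letters(1)[OF j]] card_mono[OF _ interval_letters(2)[OF j]] 
    by (simp_all add: card_image inj)
  have card2: "m - j \<le> card (\<gamma> ` {mid_label j..last_label j})" "m - \<pi> j \<le> card (\<gamma> ` {mid_label j..last_label j})"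
    using card_mono[OF _ interval_letters(3)[OF j]] card_mono[OF _ interval_letters(4)[OF j]] 
    by (simp_all add: card_image inj)
  have "R < card (\<gamma> ` {j..mid_label j})" "R < card (\<gamma> ` {mid_label j..last_label j})"
    using card1 card2 roomy[OF j] by linarith+
  then show "\<exists>l. j \<le> l \<and> l < mid_label j \<and> Suc (2 * l) \<in> set hs"
    "\<exists>l. mid_label j \<le> l \<and> l < last_label j \<and> Suc (2 * l) \<in> set hs"
    using window_hs[of "mid_label j" j] window_hs[of "last_label j" "mid_label j"] label_bounds[OF j] j by auto
qed

text \<open>Identifying the two markers \<open>s\<close>, \<open>s'\<close> of \<open>j\<close> gives \<open>j s j s j\<close>, of height five, so that \<open>j\<close> occurs in each
of the three parts.\<close>

lemma cuts_exist:
  assumes j: "j < m"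
  shows "\<exists>a b. cuts j a b"
proof -
  obtain l l' where l: "j \<le> l" "l < mid_label j" "Suc (2 * l) \<in> set hs"
    and l': "mid_label j \<le> l'" "l' < last_label j" "Suc (2 * l') \<in> set hs"
    using markers_exist[OF j] by blast
  obtain X Y Z where C: "C = X @ (m + l) # Y @ (m + l') # Z"
    "m + l \<notin> set (X @ Y @ Z)" "m + l' \<notin> set (X @ Y @ Z)"
    using markers_in_order[OF l(3) l'(3)] l l' by auto
  let ?\<phi> = "\<lambda>z. if z = m + l \<or> z = m + l' then [m] else if z = j then [j] else []"
  have "remdups_adj (concat (map ?\<phi> C)) = [j, m, j, m, j]"
    by (rule type_of_C[where qs = "[2 * j, Suc (2 * l), 2 * (mid_label j), Suc (2 * l'), 2 * (last_label j)]" and x = j and y = m])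
      (use j l l' label_bounds[OF j] occurrence_in_hs[OF j] in \<open>auto simp: marked_letter_eq_marker marked_letter_eq_letter marked_letter_simps split: if_splits\<close>)
  moreover have "concat (map ?\<phi> W) = filter (\<lambda>z. z = j) W" if "m + l \<notin> set W" "m + l' \<notin> set W" for W
    using that by (induction W) auto
  ultimately have type: "remdups_adj (filter (\<lambda>z. z = j) X @ [m] @ filter (\<lambda>z. z = j) Y @ [m] @ filter (\<lambda>z. z = j) Z) = [j, m, j, m, j]"
    using C by simp
  have rep: "filter (\<lambda>z. z = j) W = replicate (count_list W j) j" for W
    by (induction W) auto
  have "0 < count_list X j" "0 < count_list Y j" "0 < count_list Z j"
    using type unfolding rep by (cases "count_list X j"; cases "count_list Y j"; cases "count_list Z j"; 
      use j in \<open>auto simp: remdups_adj_Cons' dropWhile_append dropWhile_replicate split: if_splits\<close>)+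
  then have "cuts j (count_list X j) (count_list (X @ Y) j)"
    unfolding cuts_def using l l' C j by (intro exI[of _ l] exI[of _ l'] exI[of _ X] exI[of _ Y] exI[of _ Z]) auto
  then show ?thesis by blast
qed

end

lemma remdups_adj_five_islands:
  assumes "remdups_adj w = [i, j, i, j, i]"
  obtains e1 f1 e2 f2 e3 where "w = five_islands i j e1 f1 e2 f2 e3"
proof -
  from assms obtain e1 w1 where 1: "w = replicate e1 i @ w1" "remdups_adj w1 = [j, i, j, i]"
    by (rule remdups_adj_eq_ConsE)
  from 1(2) obtain f1 w2 where 2: "w1 = replicate f1 j @ w2" "remdups_adj w2 = [i, j, i]"
    by (rule remdups_adj_eq_ConsE)
  from 2(2) obtain e2 w3 where 3: "w2 = replicate e2 i @ w3" "remdups_adj w3 = [j, i]"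
    by (rule remdups_adj_eq_ConsE)
  from 3(2) obtain f2 w4 where 4: "w3 = replicate f2 j @ w4" "remdups_adj w4 = [i]"
    by (rule remdups_adj_eq_ConsE)
  from 4(2) obtain e3 w5 where 5: "w4 = replicate e3 i @ w5" "remdups_adj w5 = []"
    by (rule remdups_adj_eq_ConsE)
  show thesis by (rule that[of e1 f1 e2 f2 e3]) (use 1 2 3 4 5 in \<open>simp add: five_islands_def\<close>)
qed

context marked_zigzag
begin

lemma mid_label_neq: "i < m \<Longrightarrow> j < m \<Longrightarrow> i \<noteq> j \<Longrightarrow> mid_label i \<noteq> mid_label j"
  using pi[of i] pi[of j] by (auto simp: mid_label_def)

lemma pair_type:
  assumes ij: "i < j" "j < m"
  shows "remdups_adj (filter (\<lambda>z. z = i \<or> z = j) C) = [i, j, i, j, i]"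
proof -
  let ?\<phi> = "\<lambda>z. if z = i \<or> z = j then [z] else []"
  have i: "i < m" using ij by simp
  note facts = label_bounds[OF i] label_bounds[OF ij(2)] last_label_less[OF ij]
    occurrence_in_hs[OF i] occurrence_in_hs[OF ij(2)]
  have "remdups_adj (concat (map ?\<phi> C)) = [i, j, i, j, i]"
  proof (cases "mid_label i < mid_label j")
    case True
    show ?thesis
      by (rule type_of_C[where x = i and y = j and qs = "[2 * i, 2 * j, 2 * mid_label i, 2 * mid_label j, 2 * last_label j, 2 * last_label i]"])
        (use ij i True facts in \<open>auto simp: marked_letter_eq_letter marked_letter_simps split: if_splits\<close>)
  next
    case False
    then have "mid_label j < mid_label i" using mid_label_neq[OF i ij(2)] ij by simp
    then show ?thesis
      by (intro type_of_C[where x = i and y = j and qs = "[2 * i, 2 * j, 2 * mid_label j, 2 * mid_label i, 2 * last_label j, 2 * last_label i]"])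
        (use ij i facts in \<open>auto simp: marked_letter_eq_letter marked_letter_simps split: if_splits\<close>)
  qed
  then show ?thesis by (simp add: concat_map_singleton_if)
qed

text \<open>Between two consecutive places of \<open>i\<close> in the zigzag there is a place of \<open>j\<close>, so a marker there becomes
part of an island of \<open>j\<close> when it is replaced by \<open>j\<close>. The cases list the possible positions
of the marker among the six places of \<open>i\<close> and \<open>j\<close>.\<close>

lemma marker_to_larger:
  assumes ij: "i < j" "j < m" and l: "Suc (2 * l) \<in> set hs" "i \<le> l" "l < last_label i"
  shows "remdups_adj (concat (map (\<lambda>z. if z = m + l then [j] else if z = i \<or> z = j then [z] else []) C)) = [i, j, i, j, i]"
proof -
  have i: "i < m" using ij by simp
  note facts = label_bounds[OF i] label_bounds[OF ij(2)] last_label_less[OF ij]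
    occurrence_in_hs[OF i] occurrence_in_hs[OF ij(2)] l i ij
  note rl = type_of_C[where x = i and y = j]
  note simps = marked_letter_eq_letter marked_letter_eq_marker marked_letter_simps
  let ?s = "Suc (2 * l)"
  let ?i1 = "2 * i" and ?i2 = "2 * mid_label i" and ?i3 = "2 * last_label i"
  let ?j1 = "2 * j" and ?j2 = "2 * mid_label j" and ?j3 = "2 * last_label j"
  show ?thesis
  proof (cases "mid_label i < mid_label j")
    case True
    consider "l < j" | "j \<le> l" "l < mid_label i" | "mid_label i \<le> l" "l < mid_label j"
      | "mid_label j \<le> l" "l < last_label j" | "last_label j \<le> l" by linarith
    then show ?thesis
    proof cases
      case 1
      then show ?thesis by (intro rl[where qs = "[?i1, ?s, ?j1, ?i2, ?j2, ?j3, ?i3]"])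
          (use True facts in \<open>auto simp: simps split: if_splits\<close>)
    next
      case 2
      then show ?thesis by (intro rl[where qs = "[?i1, ?j1, ?s, ?i2, ?j2, ?j3, ?i3]"])
          (use True facts in \<open>auto simp: simps split: if_splits\<close>)
    next
      case 3
      then show ?thesis by (intro rl[where qs = "[?i1, ?j1, ?i2, ?s, ?j2, ?j3, ?i3]"])
          (use True facts in \<open>auto simp: simps split: if_splits\<close>)
    next
      case 4
      then show ?thesis by (intro rl[where qs = "[?i1, ?j1, ?i2, ?j2, ?s, ?j3, ?i3]"])
          (use True facts in \<open>auto simp: simps split: if_splits\<close>)
    next
      case 5
      then show ?thesis by (intro rl[where qs = "[?i1, ?j1, ?i2, ?j2, ?j3, ?s, ?i3]"])
          (use True facts in \<open>auto simp: simps split: if_splits\<close>)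
    qed
  next
    case False
    then have ord: "mid_label j < mid_label i" using mid_label_neq[OF i ij(2)] ij by simp
    consider "l < j" | "j \<le> l" "l < mid_label j" | "mid_label j \<le> l" "l < mid_label i"
      | "mid_label i \<le> l" "l < last_label j" | "last_label j \<le> l" by linarith
    then show ?thesis
    proof cases
      case 1
      then show ?thesis by (intro rl[where qs = "[?i1, ?s, ?j1, ?j2, ?i2, ?j3, ?i3]"])
          (use ord facts in \<open>auto simp: simps split: if_splits\<close>)
    next
      case 2
      then show ?thesis by (intro rl[where qs = "[?i1, ?j1, ?s, ?j2, ?i2, ?j3, ?i3]"])
          (use ord facts in \<open>auto simp: simps split: if_splits\<close>)
    next
      case 3
      then show ?thesis by (intro rl[where qs = "[?i1, ?j1, ?j2, ?s, ?i2, ?j3, ?i3]"])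
          (use ord facts in \<open>auto simp: simps split: if_splits\<close>)
    next
      case 4
      then show ?thesis by (intro rl[where qs = "[?i1, ?j1, ?j2, ?i2, ?s, ?j3, ?i3]"])
          (use ord facts in \<open>auto simp: simps split: if_splits\<close>)
    next
      case 5
      then show ?thesis by (intro rl[where qs = "[?i1, ?j1, ?j2, ?i2, ?j3, ?s, ?i3]"])
          (use ord facts in \<open>auto simp: simps split: if_splits\<close>)
    qed
  qed
qed

text \<open>The middle place of \<open>j\<close> shares an island with its last place if \<open>i\<close> comes first in \<open>\<tau>\<close>, and with its
first place otherwise. So there is a place of \<open>i\<close> only on the other side of the middle place, and it
is the marker on that side which can be replaced by \<open>i\<close> without creating an island.\<close>

lemma marker_to_smaller:
  assumes ij: "i < j" "j < m" and l: "Suc (2 * l) \<in> set hs"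
    and "mid_label i < mid_label j \<and> j \<le> l \<and> l < mid_label j \<or>
         mid_label j < mid_label i \<and> mid_label j \<le> l \<and> l < last_label j"
  shows "remdups_adj (concat (map (\<lambda>z. if z = m + l then [i] else if z = i \<or> z = j then [z] else []) C)) = [i, j, i, j, i]"
proof -
  have i: "i < m" using ij by simp
  note facts = label_bounds[OF i] label_bounds[OF ij(2)] last_label_less[OF ij]
    occurrence_in_hs[OF i] occurrence_in_hs[OF ij(2)] l i ij
  note rl = type_of_C[where x = i and y = j]
  note simps = marked_letter_eq_letter marked_letter_eq_marker marked_letter_simps
  let ?s = "Suc (2 * l)"
  let ?i1 = "2 * i" and ?i2 = "2 * mid_label i" and ?i3 = "2 * last_label i"
  let ?j1 = "2 * j" and ?j2 = "2 * mid_label j" and ?j3 = "2 * last_label j"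
  consider "mid_label i < mid_label j" "j \<le> l" "l < mid_label i" 
    | "mid_label i < mid_label j" "mid_label i \<le> l" "l < mid_label j"
    | "mid_label j < mid_label i" "mid_label j \<le> l" "l < mid_label i"
    | "mid_label j < mid_label i" "mid_label i \<le> l" "l < last_label j" using assms(4) by linarith
  then show ?thesis
  proof cases
    case 1
    then show ?thesis by (intro rl[where qs = "[?i1, ?j1, ?s, ?i2, ?j2, ?j3, ?i3]"])
        (use facts in \<open>auto simp: simps split: if_splits\<close>)
  next
    case 2
    then show ?thesis by (intro rl[where qs = "[?i1, ?j1, ?i2, ?s, ?j2, ?j3, ?i3]"])
        (use facts in \<open>auto simp: simps split: if_splits\<close>)
  next
    case 3
    then show ?thesis by (intro rl[where qs = "[?i1, ?j1, ?j2, ?s, ?i2, ?j3, ?i3]"])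
        (use facts in \<open>auto simp: simps split: if_splits\<close>)
  next
    case 4
    then show ?thesis by (intro rl[where qs = "[?i1, ?j1, ?j2, ?i2, ?s, ?j3, ?i3]"])
        (use facts in \<open>auto simp: simps split: if_splits\<close>)
  qed
qed

text \<open>By \<open>five_islands_insert\<close> the number of letters before a cut is a partial sum of exponents, and \<open>0 < a\<close>,
\<open>a < b\<close> and the bound on \<open>b\<close> leave one possibility for each cut of \<open>i\<close>. For \<open>j\<close> this works for the
cut between its two islands; the other cut splits the island in which the middle place of \<open>j\<close> is
followed or preceded by another place of \<open>j\<close>.\<close>

lemma pair_cuts:
  assumes ij: "i < j" "j < m" and ci: "cuts i a b" and cj: "cuts j a' b'"
  obtains e1 f1 e2 f2 e3 where
    "filter (\<lambda>z. z = i \<or> z = j) C = five_islands i j e1 f1 e2 f2 e3"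
    "a = e1" "b = e1 + e2" "b' < f1 + f2"
    "mid_label i < mid_label j \<and> a' = f1 \<or> mid_label j < mid_label i \<and> b' = f1"
proof -
  let ?P = "\<lambda>z. z = i \<or> z = j"
  obtain e1 f1 e2 f2 e3 where W: "filter ?P C = five_islands i j e1 f1 e2 f2 e3"
    using remdups_adj_five_islands[OF pair_type[OF ij]] by blast
  have i: "i < m" using ij by simp
  have five: "length (remdups_adj (five_islands i j e1 f1 e2 f2 e3)) = 5"
    using pair_type[OF ij] W by simp
  have tot: "count_list C i = e1 + e2 + e3" "count_list C j = f1 + f2"
    using count_list_filter[of ?P C i] count_list_filter[of ?P C j] ij unfolding W
    by (simp_all add: five_islands_def count_list_replicate_eq)
  have cut_i: "count_list V i = 0 \<or> count_list V i = e1 \<or> count_list V i = e1 + e2 \<or> count_list Z i = 0"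
    if C: "C = V @ (m + l) # Z" "m + l \<notin> set V" "m + l \<notin> set Z"
      and l: "Suc (2 * l) \<in> set hs" "i \<le> l" "l < last_label i" for V Z l
  proof -
    let ?\<phi> = "\<lambda>z. if z = m + l then [j] else if z = i \<or> z = j then [z] else []"
    have *: "concat (map ?\<phi> U) = filter ?P U" if "m + l \<notin> set U" for U
      using that by (induction U) auto
    have "concat (map ?\<phi> C) = filter ?P V @ [j] @ filter ?P Z" using C * by simp
    then have le: "length (remdups_adj (filter ?P V @ [j] @ filter ?P Z)) \<le> 5"
      using marker_to_larger[OF ij l] by simp
    have "filter ?P V @ filter ?P Z = five_islands i j e1 f1 e2 f2 e3"
      using W C ij i by simp
    from five_islands_insert(1)[OF this _ five le] ij show ?thesis by (simp add: count_list_filter)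
  qed
  have cut_j: "count_list V j = 0 \<or> count_list V j = f1 \<or> count_list Z j = 0"
    if C: "C = V @ (m + l) # Z" "m + l \<notin> set V" "m + l \<notin> set Z"
      and l: "Suc (2 * l) \<in> set hs" "mid_label i < mid_label j \<and> j \<le> l \<and> l < mid_label j \<or>
         mid_label j < mid_label i \<and> mid_label j \<le> l \<and> l < last_label j" for V Z l
  proof -
    let ?\<phi> = "\<lambda>z. if z = m + l then [i] else if z = i \<or> z = j then [z] else []"
    have *: "concat (map ?\<phi> U) = filter ?P U" if "m + l \<notin> set U" for U
      using that by (induction U) auto
    have "concat (map ?\<phi> C) = filter ?P V @ [i] @ filter ?P Z" using C * by simp
    then have le: "length (remdups_adj (filter ?P V @ [i] @ filter ?P Z)) \<le> 5"
      using marker_to_smaller[OF ij l] by simp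
    have "filter ?P V @ filter ?P Z = five_islands i j e1 f1 e2 f2 e3"
      using W C ij i by simp
    from five_islands_insert(2)[OF this _ five le] ij show ?thesis by (simp add: count_list_filter)
  qed
  have i_cuts: "a = e1 \<and> b = e1 + e2"
  proof -
    from ci obtain l l' X Y Z where l: "i \<le> l" "l < mid_label i" "mid_label i \<le> l'" "l' < last_label i"
       "Suc (2 * l) \<in> set hs" "Suc (2 * l') \<in> set hs"
     and C: "C = X @ (m + l) # Y @ (m + l') # Z"
     "m + l \<notin> set (X @ Y @ Z)" "m + l' \<notin> set (X @ Y @ Z)"
     and ab: "a = count_list X i" "b = count_list (X @ Y) i" "0 < a" "a < b" "b < count_list C i"
      unfolding cuts_def by blast
    have "a = 0 \<or> a = e1 \<or> a = e1 + e2 \<or> count_list (Y @ (m + l') # Z) i = 0"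
      unfolding ab(1) by (rule cut_i[of X l "Y @ (m + l') # Z"]) (use C l label_bounds[OF i] in auto)
    moreover have "count_list (X @ (m + l) # Y) i = 0 \<or> count_list (X @ (m + l) # Y) i = e1 
        \<or> count_list (X @ (m + l) # Y) i = e1 + e2 \<or> count_list Z i = 0"
      by (rule cut_i[of "X @ (m + l) # Y" l' Z]) (use C l label_bounds[OF i] in auto)
    moreover have "count_list C i = count_list X i + count_list Y i + count_list Z i" using C(1) i by simp
    ultimately show ?thesis using ab i by auto
  qed
  have j_cuts: "mid_label i < mid_label j \<and> a' = f1 \<or> mid_label j < mid_label i \<and> b' = f1" and "b' < f1 + f2"
  proof -
    from cj obtain l l' X Y Z where l: "j \<le> l" "l < mid_label j" "mid_label j \<le> l'" "l' < last_label j"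
       "Suc (2 * l) \<in> set hs" "Suc (2 * l') \<in> set hs"
     and C: "C = X @ (m + l) # Y @ (m + l') # Z"
     "m + l \<notin> set (X @ Y @ Z)" "m + l' \<notin> set (X @ Y @ Z)"
     and ab: "a' = count_list X j" "b' = count_list (X @ Y) j" "0 < a'" "a' < b'" "b' < count_list C j"
      unfolding cuts_def by blast
    have tot': "count_list C j = count_list X j + count_list Y j + count_list Z j" using C(1) ij by simp
    show "b' < f1 + f2" using ab(5) tot by simp
    have "mid_label i \<noteq> mid_label j" using mid_label_neq[OF i ij(2)] ij by simp
    then consider "mid_label i < mid_label j" | "mid_label j < mid_label i" by linarith
    then show "mid_label i < mid_label j \<and> a' = f1 \<or> mid_label j < mid_label i \<and> b' = f1"
    proof cases
      case 1
      have "count_list X j = 0 \<or> count_list X j = f1 \<or> count_list (Y @ (m + l') # Z) j = 0"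
        by (rule cut_j[of X l "Y @ (m + l') # Z"]) (use C l 1 in auto)
      then show ?thesis using 1 ab tot' ij by auto
    next
      case 2
      have "count_list (X @ (m + l) # Y) j = 0 \<or> count_list (X @ (m + l) # Y) j = f1 \<or> count_list Z j = 0"
        by (rule cut_j[of "X @ (m + l) # Y" l' Z]) (use C l 2 in auto)
      then show ?thesis using 2 ab tot' ij by auto
    qed
  qed
  show thesis using that[OF W] i_cuts j_cuts \<open>b' < f1 + f2\<close> by blast
qed

text \<open>Each occurrence of \<open>j\<close> is labelled as first, middle or last according to the number of earlier
occurrences. Sortedness of the labels concerns two occurrences at a time, hence at most two letters,
for which \<open>pair_cuts\<close> applies.\<close>

lemma follows_zigzag_erased: "follows_zigzag (filter (\<lambda>z. z < m) C)"
proof -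
  define B where "B = filter (\<lambda>z. z < m) C"
  have "\<exists>ab. cuts j (fst ab) (snd ab)" if "j < m" for j using cuts_exist[OF that] by auto
  then obtain ab where ab: "\<And>j. j < m \<Longrightarrow> cuts j (fst (ab j)) (snd (ab j))" by metis
  define a b where "a j = fst (ab j)" and "b j = snd (ab j)" for j
  have cuts: "cuts j (a j) (b j)" if "j < m" for j using ab that by (simp add: a_def b_def)
  have bounds: "0 < a j" "a j < b j" "b j < count_list B j" if "j < m" for j
    using cuts[OF that] that unfolding cuts_def B_def by (auto simp: count_list_filter)
  define lab where "lab j c = (if c < a j then j else if c < b j then mid_label j else last_label j)" for j c
  define cnt where "cnt k j = count_list (take k B) j" for k j
  define ls where "ls = map (\<lambda>k. lab (B ! k) (cnt k (B ! k))) [0..<length B]"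
  have B_less: "B ! k < m" if "k < length B" for k
    using that nth_mem[of k B] by (auto simp: B_def)
  have lab_less: "lab j c < 3 * m" if "j < m" for j c
    using label_bounds[OF that] that by (auto simp: lab_def)
  have lab_letter: "\<gamma> (lab j c) = j" if "j < m" for j c
    using gamma_eq_label[OF lab_less[OF that] that] by (auto simp: lab_def)
  have "map \<gamma> ls = B"
    by (rule nth_equalityI) (auto simp: ls_def lab_letter B_less)
  moreover have "set ls = {..<3 * m}"
  proof (intro equalityI subsetI)
    fix l assume "l \<in> {..<3 * m}"
    then have l: "l < 3 * m" by simp
    define j where "j = \<gamma> l"
    have j: "j < m" using gamma_less[OF l] by (simp add: j_def)
    have "l = j \<or> l = mid_label j \<or> l = last_label j"
      using gamma_eq_label[OF l j] j_def by blast
    moreover have "lab j 0 = j" "lab j (a j) = mid_label j" "lab j (b j) = last_label j"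
      using bounds[OF j] by (auto simp: lab_def)
    moreover have "0 < count_list B j" "a j < count_list B j" using bounds[OF j] by linarith+
    ultimately have "\<exists>c<count_list B j. lab j c = l" using bounds(3)[OF j] by metis
    then obtain c where c: "c < count_list B j" "lab j c = l" by blast
    obtain k where "k < length B" "B ! k = j" "cnt k j = c"
      using count_list_nth_witness[OF c(1)] unfolding cnt_def by blast
    then show "l \<in> set ls" using c by (auto simp: ls_def)
  qed (auto simp: ls_def lab_less B_less)
  moreover have "sorted ls"
  proof -
    have "lab (B ! k) (cnt k (B ! k)) \<le> lab (B ! k') (cnt k' (B ! k'))" if k: "k < k'" "k' < length B" for k k'
    proof -
      have less: "cnt k (B ! k) < cnt k' (B ! k)" and le: "cnt k x \<le> cnt k' x" for x
        using count_list_take_less[of k k' B] k unfolding cnt_def by auto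
      have main: "lab (B ! k) (cnt k (B ! k)) \<le> lab (B ! k') (cnt k' (B ! k'))"
        if ij: "i < j" "j < m" and kk: "{B ! k, B ! k'} = {i, j}" for i j
      proof -
        let ?P = "\<lambda>z. z = i \<or> z = j"
        have i: "i < m" using ij by simp
        obtain e1 f1 e2 f2 e3 where W: "filter ?P C = five_islands i j e1 f1 e2 f2 e3"
          and e: "a i = e1" "b i = e1 + e2" "b j < f1 + f2"
          "mid_label i < mid_label j \<and> a j = f1 \<or> mid_label j < mid_label i \<and> b j = f1"
          using pair_cuts[OF ij cuts[OF i] cuts[OF ij(2)]] by blast
        have "filter ?P B = filter ?P C" unfolding B_def using ij by (auto intro!: filter_cong)
        then have W': "filter ?P B = five_islands i j e1 f1 e2 f2 e3" using W by simp
        have pos: "B ! k = i \<and> (cnt k i < e1 \<and> cnt k j = 0 \<or>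
                  e1 \<le> cnt k i \<and> cnt k i < e1 + e2 \<and> cnt k j = f1 \<or>
                  e1 + e2 \<le> cnt k i \<and> cnt k j = f1 + f2) \<or>
           B ! k = j \<and> (cnt k i = e1 \<and> cnt k j < f1 \<or>
                  cnt k i = e1 + e2 \<and> f1 \<le> cnt k j \<and> cnt k j < f1 + f2)"
          if "k < length B" "B ! k \<in> {i, j}" for k
        proof -
          have "filter ?P B = filter ?P (take k B) @ B ! k # filter ?P (drop (Suc k) B)"
            using that(2) by (subst id_take_nth_drop[OF that(1)]) auto
          then have "filter ?P (take k B) @ B ! k # filter ?P (drop (Suc k) B) = five_islands i j e1 f1 e2 f2 e3"
            using W' by simp
          from five_islands_prefix[OF this] ij show ?thesis by (simp add: count_list_filter cnt_def)
        qed
        have in_ij: "B ! k \<in> {i, j}" "B ! k' \<in> {i, j}" using kk by auto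
        note facts = label_bounds[OF i] label_bounds[OF ij(2)] last_label_less[OF ij] bounds[OF i] bounds[OF ij(2)]
          less le[of i] le[of j] e pos[OF _ in_ij(1)] pos[OF _ in_ij(2)] 
        consider "B ! k = i" "B ! k' = j" | "B ! k = j" "B ! k' = i" using kk ij by (auto simp: doubleton_eq_iff)
        then show ?thesis
        proof cases
          case 1
          then show ?thesis using facts k ij by (auto simp: lab_def)
        next
          case 2
          then show ?thesis using facts k ij by (auto simp: lab_def)
        qed
      qed
      show ?thesis
      proof (cases "B ! k = B ! k'")
        case True
        have m: "B ! k' < m" by (rule B_less[OF k(2)])
        show ?thesis using less bounds[OF m] label_bounds[OF m] m unfolding True by (auto simp: lab_def)
      next
        case False
        have "B ! k < m" "B ! k' < m" using B_less k by auto
        then show ?thesis using main[of "B ! k" "B ! k'"] main[of "B ! k'" "B ! k"] False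
          by (metis insert_commute linorder_neqE_nat)
      qed
    qed
    then show ?thesis by (auto simp: ls_def sorted_iff_nth_mono_less)
  qed
  ultimately show ?thesis unfolding follows_zigzag_def B_def by blast
qed

end

section \<open>Deductions preserve zigzag words\<close>

text \<open>The context \<open>p\<close>, \<open>q\<close> is absorbed into the identity by two new letters, which explains the summand 2.\<close>

lemma (in zigzag) follows_zigzag_preserved:
  assumes T: "type_faithful u v" and R: "card (set u) + 2 \<le> R"
    and Z: "follows_zigzag (p @ concat (map \<Theta> u) @ q)"
  shows "follows_zigzag (p @ concat (map \<Theta> v) @ q)"
proof -
  obtain s where s: "s \<notin> set u \<union> set v" using ex_new_if_finite[of "set u \<union> set v"] by auto
  obtain t where t: "t \<notin> set u \<union> set v \<union> {s}" using ex_new_if_finite[of "set u \<union> set v \<union> {s}"] by auto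
  define \<Theta>' where "\<Theta>' = \<Theta>(s := p, t := q)"
  have eq: "concat (map \<Theta>' ([s] @ w @ [t])) = p @ concat (map \<Theta> w) @ q" if "set w \<subseteq> set u \<union> set v" for w
  proof -
    have "map \<Theta>' w = map \<Theta> w" using that s t by (auto simp: \<Theta>'_def)
    moreover have "\<Theta>' s = p" "\<Theta>' t = q" using t by (auto simp: \<Theta>'_def)
    ultimately show ?thesis by (simp del: map_eq_conv)
  qed
  have "type_faithful ([s] @ u @ [t]) ([s] @ v @ [t])" by (rule type_faithful_context[OF T])
  moreover have "card (set ([s] @ u @ [t])) \<le> R"
    using R by (simp add: card_insert_if)
  moreover have "follows_zigzag (concat (map \<Theta>' ([s] @ u @ [t])))" using Z eq[of u] by simp
  ultimately obtain hs C where *: "type_faithful (map marked_letter hs) C" "sorted_wrt half_before hs"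
    "\<And>l. 2 * l \<in> set hs \<longleftrightarrow> l < 3 * m"
    "\<And>a b. b < 3 * m \<Longrightarrow> R < card (\<gamma> ` {a..b}) \<Longrightarrow> \<exists>l. a \<le> l \<and> l < b \<and> 2 * l + 1 \<in> set hs"
    "filter (\<lambda>z. z < m) C = concat (map \<Theta>' ([s] @ v @ [t]))"
    by (rule insert_markers) blast
  interpret marked_zigzag m R \<tau> \<pi> hs C
    by unfold_locales (use * in auto)
  show ?thesis using follows_zigzag_erased *(5) eq[of v] by simp
qed

text \<open>Quantifying over all contexts and all substitutions, including those which delete letters, makes the
claim stable under every rule of deduction.\<close>

lemma (in zigzag) deducible_preserves_zigzag:
  assumes \<Sigma>: "\<And>u v. (u, v) \<in> \<Sigma> \<Longrightarrow> type_faithful u v \<and> type_faithful v u \<and> card (set u) + 2 \<le> R"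
    and "deducible \<Sigma> u v"
  shows "follows_zigzag (p @ concat (map \<Theta> u) @ q) \<longleftrightarrow> follows_zigzag (p @ concat (map \<Theta> v) @ q)"
  using assms(2)
proof (induction arbitrary: p q \<Theta> rule: deducible.induct)
  case (ax u v)
  have "card (set v) + 2 \<le> R" using \<Sigma>[OF ax] type_faithful_set by metis
  then show ?case using follows_zigzag_preserved \<Sigma>[OF ax] by blast
next
  case (mult u v u' v')
  have "follows_zigzag (p @ concat (map \<Theta> (u @ u')) @ q)
      \<longleftrightarrow> follows_zigzag (p @ concat (map \<Theta> u) @ (concat (map \<Theta> u') @ q))" by simp
  also have "\<dots> \<longleftrightarrow> follows_zigzag (p @ concat (map \<Theta> v) @ (concat (map \<Theta> u') @ q))"
    by (rule mult.IH(1))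
  also have "\<dots> \<longleftrightarrow> follows_zigzag ((p @ concat (map \<Theta> v)) @ concat (map \<Theta> u') @ q)" by simp
  also have "\<dots> \<longleftrightarrow> follows_zigzag ((p @ concat (map \<Theta> v)) @ concat (map \<Theta> v') @ q)"
    by (rule mult.IH(2))
  finally show ?case by simp
next
  case (subst u v \<phi>)
  have eq: "concat (map \<Theta> (concat (map \<phi> w))) = concat (map (\<lambda>z. concat (map \<Theta> (\<phi> z))) w)" for w
    by (induction w) auto
  show ?case unfolding eq by (rule subst.IH)
qed (auto)

section \<open>Reading a square grid by rows and by columns\<close>

text \<open>Transposition of the \<open>n \<times> n\<close> grid whose cells are numbered \<open>0, ..., n\<^sup>2 - 1\<close> row by row.\<close>

definition grid_swap :: "nat \<Rightarrow> nat \<Rightarrow> nat" where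
  "grid_swap n q = q mod n * n + q div n"

lemma grid_swap_mult_add: "b < n \<Longrightarrow> grid_swap n (a * n + b) = b * n + a"
  by (simp add: grid_swap_def)

lemma grid_coords:
  fixes n q :: nat
  assumes "q < n * n"
  obtains a b where "q = a * n + b" "a < n" "b < n"
proof
  have n: "0 < n" using assms by (cases n) auto
  show "q = q div n * n + q mod n" by simp
  show "q div n < n" using assms by (simp add: less_mult_imp_div_less)
  show "q mod n < n" using n by simp
qed

lemma grid_less:
  fixes n a b :: nat
  assumes "a < n" "b < n"
  shows "a * n + b < n * n"
proof -
  have "a * n + b < Suc a * n" using assms by simp
  also have "\<dots> \<le> n * n" using assms by (intro mult_le_mono1) simp
  finally show ?thesis .
qed

lemma grid_swap_involution: "q < n * n \<Longrightarrow> grid_swap n q < n * n \<and> grid_swap n (grid_swap n q) = q"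
  by (erule grid_coords) (auto simp: grid_swap_mult_add grid_less)

lemma grid_swap_last: "0 < n \<Longrightarrow> grid_swap n (n * n - 1) = n * n - 1"
  using grid_swap_mult_add[of "n - 1" n "n - 1"] by (cases n) (auto simp: algebra_simps)

lemma grid_swap_less:
  assumes q: "q < n * n - 1"
  shows "grid_swap n q < n * n - 1 \<and> grid_swap n (grid_swap n q) = q"
proof -
  have *: "grid_swap n q < n * n" "grid_swap n (grid_swap n q) = q" using grid_swap_involution[of q n] q by auto
  have "grid_swap n q \<noteq> n * n - 1"
  proof
    assume "grid_swap n q = n * n - 1"
    then have "q = grid_swap n (n * n - 1)" using *(2) by simp
    moreover have "0 < n" using q by (cases n) auto
    ultimately show False using q grid_swap_last by simp
  qed
  then show ?thesis using * by simp
qed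

lemma grid_swap_Suc:
  assumes "Suc q < n * n"
  shows "grid_swap n (Suc q) = grid_swap n q + n \<or> grid_swap n (Suc q) + (n - 1) * n = Suc (grid_swap n q)"
proof -
  obtain a b where q: "q = a * n + b" "a < n" "b < n" using grid_coords[of q n] assms by auto
  show ?thesis
  proof (cases "Suc b < n")
    case True
    then have "grid_swap n (Suc q) = Suc b * n + a" using grid_swap_mult_add[of "Suc b" n a] q by simp
    then show ?thesis using q by (simp add: grid_swap_mult_add)
  next
    case False
    then have b: "b = n - 1" using q by simp
    then have Suc: "Suc q = Suc a * n + 0" using q by simp
    have "0 < n" using q by simp
    then have "grid_swap n (Suc q) = Suc a" unfolding Suc by (subst grid_swap_mult_add) auto
    moreover have "grid_swap n q = (n - 1) * n + a" using q b by (simp only: grid_swap_mult_add)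
    ultimately show ?thesis by simp
  qed
qed

text \<open>Adjacent places are told apart by the difference of their letters: it is \<open>1\<close> on the way up and \<open>-1\<close> on
the way down, while in the columns it is \<open>n\<close>, or \<open>n - m\<close> when a new column begins; the two bends give
\<open>1 - m\<close> and \<open>n - 1\<close>. The last cell is left out because its letter would have adjacent middle and last
places. For the remaining letters of the last row, which are the only ones close to the end of the way
up, nearly a whole column precedes and another one follows in \<open>\<tau>\<close>.\<close>

lemma grid_swap_zigzag:
  assumes n: "R + 2 < n" "3 < n"
  shows "zigzag (n * n - 1) R (grid_swap n) (grid_swap n)"
proof -
  define m where "m = n * n - 1"
  let ?\<tau> = "grid_swap n" and ?\<gamma> = "letter_at m (grid_swap n)"
  have nn: "4 * n \<le> n * n" using n(2) by (intro mult_le_mono1) simp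
  then have nm: "4 * n \<le> m + 1" "m + 1 = n * n" using n by (auto simp: m_def)
  then have "n < m" using n by linarith
  with nm have nm: "4 * n \<le> m + 1" "n < m" "m + 1 = n * n" by auto
  have tau: "?\<tau> q < m" "?\<tau> (?\<tau> q) = q" if "q < m" for q
    using grid_swap_less[of q n] that by (auto simp: m_def)
  have tau_Suc: "?\<tau> (Suc q) = ?\<tau> q + n \<or> ?\<tau> (Suc q) + (m - n) = ?\<tau> q" if "Suc q < m" for q
  proof -
    have "(n - 1) * n = n * n - n" by (simp add: algebra_simps)
    then have "(n - 1) * n = Suc (m - n)" using nm by simp
    then show ?thesis using grid_swap_Suc[of q n] that by (auto simp: m_def)
  qed
  have tau_0: "?\<tau> 0 = 0" by (simp add: grid_swap_def)
  have tau_end: "?\<tau> (m - 1) + n = m"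
  proof -
    have eq: "m - 1 = (n - 1) * n + (n - 2)"
      using n nm(3) by (cases n; cases "n - 1") (auto simp: algebra_simps)
    have "?\<tau> (m - 1) = (n - 2) * n + (n - 1)"
      unfolding eq using n by (subst grid_swap_mult_add) auto
    moreover have "(n - 2) * n + 2 * n = n * n" using n by (metis add_mult_distrib le_add_diff_inverse2 less_imp_le numeral_2_eq_2 Suc_lessD numeral_3_eq_3)
    ultimately show ?thesis using nm n by simp
  qed
  have g1: "?\<gamma> l = l" if "l < m" for l using that by (simp add: letter_at_def)
  have g2: "?\<gamma> (m + q) = ?\<tau> q" if "q < m" for q using that by (simp add: letter_at_def)
  have g3: "?\<gamma> l = 3 * m - 1 - l" if "2 * m \<le> l" for l using that by (simp add: letter_at_def)
  define d where "d l = int (?\<gamma> (Suc l)) - int (?\<gamma> l)" for l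
  have d: "d l = 1 \<and> l + 1 < m \<or> d l = 1 - int m \<and> l + 1 = m \<or>
      d l = int n \<and> m \<le> l \<and> l + 1 < 2 * m \<or> d l = int n - int m \<and> m \<le> l \<and> l + 1 < 2 * m \<or>
      d l = int n - 1 \<and> l + 1 = 2 * m \<or> d l = - 1 \<and> 2 * m \<le> l" if "Suc l < 3 * m" for l
  proof -
    consider "l + 1 < m" | "l + 1 = m" | "m \<le> l" "l + 1 < 2 * m" | "l + 1 = 2 * m" | "2 * m \<le> l" by linarith
    then show ?thesis
    proof cases
      case 1
      then show ?thesis by (simp add: g1 d_def)
    next
      case 2
      then have "?\<gamma> l = l" "?\<gamma> (Suc l) = 0" using g1[of l] g2[of 0] tau_0 \<open>n < m\<close> by auto
      then have "d l = 1 - int m" using 2 by (simp add: d_def)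
      then show ?thesis using 2 by simp
    next
      case 3
      define q where "q = l - m"
      have q: "l = m + q" "Suc q < m" using 3 by (auto simp: q_def)
      then have "?\<gamma> l = ?\<tau> q" "?\<gamma> (Suc l) = ?\<tau> (Suc q)" using g2[of q] g2[of "Suc q"] by auto
      then have "d l = int n \<or> d l = int n - int m"
        using tau_Suc[OF q(2)] \<open>n < m\<close> unfolding d_def by linarith
      then show ?thesis using 3 by blast
    next
      case 4
      then have l: "l = m + (m - 1)" by simp
      have "?\<gamma> l = ?\<tau> (m - 1)" unfolding l using \<open>n < m\<close> by (intro g2) simp
      moreover have "?\<gamma> (Suc l) + 1 = m" using g3[of "Suc l"] 4 \<open>n < m\<close> by simp
      ultimately have "d l = int n - 1" using tau_end unfolding d_def by linarith
      then show ?thesis using 4 by blast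
    next
      case 5
      then have "?\<gamma> l = 3 * m - 1 - l" "?\<gamma> (Suc l) = 3 * m - 1 - Suc l" using g3 by auto
      moreover have "3 * m - 1 - l = 3 * m - 1 - Suc l + 1" using that by linarith
      ultimately have "d l = - 1" by (simp add: d_def)
      then show ?thesis using 5 by blast
    qed
  qed
  have d_section: "(l < m \<longleftrightarrow> d l = 1 \<or> d l = 1 - int m) \<and> (2 * m \<le> l \<longleftrightarrow> d l = - 1)" if "Suc l < 3 * m" for l
  proof -
    have "n + 2 < m" using nm(1) n(2) by linarith
    then show ?thesis using d[OF that] n(2) by (elim disjE conjE) auto
  qed
  show ?thesis
    unfolding m_def[symmetric]
  proof
    show "?\<tau> q < m \<and> ?\<tau> (?\<tau> q) = q" if "q < m" for q using tau that by simp
    show "?\<gamma> l \<noteq> ?\<gamma> (Suc l)" if "Suc l < 3 * m" for l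
    proof -
      have "d l \<noteq> 0" using d[OF that] \<open>n < m\<close> n(2) by linarith
      then show ?thesis by (simp add: d_def)
    qed
    show "l = l'" if l: "Suc l < 3 * m" "Suc l' < 3 * m" and eq: "?\<gamma> l = ?\<gamma> l'" "?\<gamma> (Suc l) = ?\<gamma> (Suc l')" for l l'
    proof -
      have "d l = d l'" using eq by (simp add: d_def)
      then have "l < m \<longleftrightarrow> l' < m" "2 * m \<le> l \<longleftrightarrow> 2 * m \<le> l'"
        using d_section[OF l(1)] d_section[OF l(2)] by simp_all
      then consider "l < m" "l' < m" | "m \<le> l" "m \<le> l'" "l < 2 * m" "l' < 2 * m" | "2 * m \<le> l" "2 * m \<le> l'"
        by (meson not_less)
      then show ?thesis
      proof cases
        case 1
        then show ?thesis using eq(1) by (simp add: g1)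
      next
        case 2
        then have "?\<tau> (l - m) = ?\<tau> (l' - m)" using eq(1) by (simp add: letter_at_def)
        moreover have "l - m < m" "l' - m < m" using 2 by auto
        ultimately have "l - m = l' - m" using tau(2) by metis
        then show ?thesis using 2 by simp
      next
        case 3
        then show ?thesis using eq(1) l by (simp add: g3)
      qed
    qed
    show "R < m - j \<or> R \<le> ?\<tau> j \<and> R < m - ?\<tau> j" if j: "j < m" for j
    proof (cases "R < m - j")
      case False
      obtain a b where ab: "j = a * n + b" "a < n" "b < n" using grid_coords[of j n] j nm by auto
      have a: "a = n - 1"
      proof (rule ccontr)
        assume "a \<noteq> n - 1"
        then have "Suc (Suc a) * n \<le> n * n" using ab by (intro mult_le_mono1) simp
        then show False using False ab nm n by simp
      qed
      have nn1: "(n - 1) * n + n = n * n" using n by (cases n) auto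
      have t: "?\<tau> j = b * n + (n - 1)" using ab a by (simp add: grid_swap_mult_add)
      have "b \<noteq> n - 1" using j ab a nn1 nm n by auto
      then have "Suc (Suc b) * n \<le> n * n" using ab by (intro mult_le_mono1) simp
      then have "b * n + 2 * n \<le> m + 1" using nm(3) by simp
      then have "?\<tau> j + R < m" using t n by linarith
      moreover have "R \<le> ?\<tau> j" using t n by linarith
      ultimately show ?thesis by linarith
    qed simp
  qed
qed

lemma concat_upt_blocks:
  "concat (map (\<lambda>i. concat (map (\<lambda>j. f (i * n + j)) [0..<n])) [0..<c]) = concat (map f [0..<c * n])"
proof (induction c)
  case (Suc c)
  have "[0..<Suc c * n] = [0..<c * n] @ map (\<lambda>j. c * n + j) [0..<n]"
  proof -
    have "[0..<Suc c * n] = [0..<c * n] @ [c * n..<c * n + n]"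
      using upt_add_eq_append[of 0 "c * n" n] by (simp add: add.commute)
    also have "[c * n..<c * n + n] = map (\<lambda>j. c * n + j) [0..<n]"
      by (rule nth_equalityI) auto
    finally show ?thesis .
  qed
  then show ?case using Suc by (simp add: o_def)
qed simp

section \<open>The two sides of the identity\<close>

lemma J_word_grid_swap: "J_word n k = concat (map (\<lambda>q. replicate k (grid_swap n q + 1)) [0..<n * n])"
proof -
  have "[1..<n + 1] = map Suc [0..<n]" by (simp add: map_Suc_upt)
  then have "J_word n k = concat (map (\<lambda>i. concat (map (\<lambda>j. replicate k (Suc i + j * n)) [0..<n])) [0..<n])"
    unfolding J_word_def by (simp only: map_map o_def)
  also have "\<dots> = concat (map (\<lambda>i. concat (map (\<lambda>j. replicate k (grid_swap n (i * n + j) + 1)) [0..<n])) [0..<n])"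
    by (intro arg_cong[where f = concat] map_cong HOL.refl) (simp add: grid_swap_mult_add)
  also have "\<dots> = concat (map (\<lambda>q. replicate k (grid_swap n q + 1)) [0..<n * n])"
    by (rule concat_upt_blocks)
  finally show ?thesis .
qed

text \<open>The substitution deletes the letter \<open>n\<^sup>2\<close> and shifts the others, so that they are numbered from \<open>0\<close>.\<close>

lemma J_word_project:
  assumes "0 < n"
  defines "m \<equiv> n * n - 1"
  defines "\<Theta> \<equiv> \<lambda>x. if 0 < x \<and> x \<le> m then [x - 1] else []"
  shows "concat (map \<Theta> (linear_word n)) = [0..<m]"
    "concat (map \<Theta> (J_word n k)) = concat (map (\<lambda>q. replicate k (grid_swap n q)) [0..<m])"
    "concat (map \<Theta> (rev w)) = rev (concat (map \<Theta> w))"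
proof -
  have nn: "n * n = Suc m" using assms by (cases n) auto
  have "linear_word n = map Suc [0..<m] @ [Suc m]"
    unfolding linear_word_def power2_eq_square nn by (simp add: map_Suc_upt)
  moreover have "concat (map \<Theta> (map Suc [0..<m])) = concat (map (\<lambda>x. [x]) [0..<m])"
    unfolding map_map by (intro arg_cong[where f = concat] map_cong HOL.refl) (simp add: \<Theta>_def)
  ultimately show "concat (map \<Theta> (linear_word n)) = [0..<m]" by (simp add: \<Theta>_def)
  have rep: "concat (map \<Theta> (concat (map (\<lambda>q. replicate k (f q)) qs))) = 
    concat (map (\<lambda>q. concat (replicate k (\<Theta> (f q)))) qs)" for f and qs :: "nat list"
    by (induction qs) auto
  have last: "grid_swap n m = m" using grid_swap_last assms by (simp add: m_def)
  have "concat (map \<Theta> (J_word n k)) = concat (map (\<lambda>q. concat (replicate k (\<Theta> (grid_swap n q + 1)))) [0..<m])"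
    unfolding J_word_grid_swap rep nn using last by (simp add: \<Theta>_def)
  also have "\<dots> = concat (map (\<lambda>q. replicate k (grid_swap n q)) [0..<m])"
  proof (intro arg_cong[where f = concat] map_cong HOL.refl)
    fix q assume "q \<in> set [0..<m]"
    then have "grid_swap n q < m" using grid_swap_less[of q n] by (simp add: m_def)
    moreover have "concat (replicate k [z]) = replicate k z" for z :: nat by (induction k) auto
    ultimately show "concat (replicate k (\<Theta> (grid_swap n q + 1))) = replicate k (grid_swap n q)"
      by (simp add: \<Theta>_def)
  qed
  finally show "concat (map \<Theta> (J_word n k)) = concat (map (\<lambda>q. replicate k (grid_swap n q)) [0..<m])" .
  show "concat (map \<Theta> (rev w)) = rev (concat (map \<Theta> w))"
    by (induction w) (auto simp: \<Theta>_def)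
qed

lemma (in zigzag) follows_zigzag_intro:
  assumes "1 \<le> k"
  shows "follows_zigzag ([0..<m] @ concat (map (\<lambda>q. replicate k (\<tau> q)) [0..<m]) @ rev [0..<m])"
proof -
  let ?ls = "[0..<m] @ concat (map (\<lambda>q. replicate k (m + q)) [0..<m]) @ [2 * m..<3 * m]"
  have mid: "set (concat (map (\<lambda>q. replicate k (m + q)) [0..<m])) = {m..<2 * m}"
  proof -
    have "set (concat (map (\<lambda>q. replicate k (m + q)) [0..<m])) = (\<lambda>q. m + q) ` {0..<m}"
    proof -
      have rep: "set (replicate k x) = {x}" for x using assms by simp
      have "set (concat (map (\<lambda>q. replicate k (m + q)) [0..<m])) = (\<Union>q\<in>{0..<m}. {m + q})"
        by (simp only: set_concat set_map set_upt image_image rep)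
      then show ?thesis by blast
    qed
    also have "\<dots> = {m..<2 * m}" by (simp add: mult_2)
    finally show ?thesis .
  qed
  have "sorted (concat (map (\<lambda>q. replicate k (m + q)) [0..<c]))" for c
  proof (induction c)
    case (Suc c)
    have le: "x \<le> m + c" if "x \<in> set (concat (map (\<lambda>q. replicate k (m + q)) [0..<c]))" for x
      using that by (auto simp: set_replicate_conv_if split: if_splits)
    moreover have "sorted (replicate k (m + c))" by simp
    ultimately show ?case using Suc by (simp add: sorted_append set_replicate_conv_if del: set_concat)
  qed simp
  then have "sorted ?ls" by (auto simp add: sorted_append mid simp del: set_concat) 
  moreover have "set ?ls = {..<3 * m}" unfolding set_append mid by auto
  moreover have "map \<gamma> [0..<m] = [0..<m]" by (rule map_idI) (simp add: letter_at_def)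
  moreover have "map \<gamma> (concat (map (\<lambda>q. replicate k (m + q)) [0..<m])) = concat (map (\<lambda>q. replicate k (\<tau> q)) [0..<m])"
    unfolding map_concat map_map
    by (intro arg_cong[where f = concat] map_cong HOL.refl) (simp add: letter_at_def)
  moreover have "map \<gamma> [2 * m..<3 * m] = rev [0..<m]"
    by (rule nth_equalityI) (auto simp: letter_at_def rev_nth)
  ultimately show ?thesis unfolding follows_zigzag_def by (intro exI[of _ ?ls]) (simp del: set_concat)
qed

text \<open>The part before the final descent ends with \<open>0\<close>, and this \<open>0\<close> is not labelled as a last one because
the descent still contains \<open>j\<close>. So all places after the middle one of \<open>0\<close> occur as labels of the
descent, among them the middle and the last place of \<open>j\<close>; but the descent contains \<open>j\<close> once.\<close>

lemma (in zigzag) not_follows_zigzag_rev: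
  assumes k: "1 \<le> k" and \<pi>: "\<pi> 0 = 0" "\<pi> j = 1" and j: "0 < j" "j < m"
  shows "\<not> follows_zigzag ([0..<m] @ rev (concat (map (\<lambda>q. replicate k (\<tau> q)) [0..<m])) @ rev [0..<m])"
proof
  let ?X = "[0..<m] @ rev (concat (map (\<lambda>q. replicate k (\<tau> q)) [0..<m]))"
  assume "follows_zigzag ([0..<m] @ rev (concat (map (\<lambda>q. replicate k (\<tau> q)) [0..<m])) @ rev [0..<m])"
  then obtain ls where ls: "sorted ls" "set ls = {..<3 * m}" "map \<gamma> ls = ?X @ rev [0..<m]"
    unfolding follows_zigzag_def by auto
  obtain lx lz where "ls = lx @ lz" "?X = map \<gamma> lx" "rev [0..<m] = map \<gamma> lz"
    using map_eq_append_conv[THEN iffD1, OF ls(3)] by blast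
  note split = this(1) this(2,3)[symmetric]
  have m: "0 < m" using j by simp
  have "\<tau> 0 = 0" using pi[of 0] m \<pi>(1) by simp
  then have X: "?X = ([0..<m] @ rev (concat (map (\<lambda>q. replicate k (\<tau> q)) [1..<m])) @ replicate (k - 1) 0) @ [0]"
    using k m by (cases k) (auto simp: upt_conv_Cons replicate_append_same)
  have ne: "lx \<noteq> []" using split(2) m by auto
  have last: "\<gamma> (last lx) = 0" using split(2) ne X by (metis last_map last_snoc)
  have le: "x \<le> y" if "x \<in> set lx" "y \<in> set lz" for x y
    using ls(1) that unfolding split(1) by (auto simp: sorted_append)
  have lx_le: "x \<le> last lx" if "x \<in> set lx" for x
  proof -
    have "sorted (butlast lx @ [last lx])" using ls(1) ne unfolding split(1) by (simp add: sorted_append)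
    then have "\<forall>y\<in>set (butlast lx). y \<le> last lx" by (simp only: sorted_append) simp
    moreover have "x \<in> set (butlast lx @ [last lx])" using that ne by simp
    ultimately show ?thesis unfolding set_append by auto
  qed
  have lt: "last lx < 3 * m" using ls(2) ne unfolding split(1) by (metis UnCI last_in_set lessThan_iff set_append)
  \<comment> \<open>The label \<open>3 m - 1\<close> is the last place of \<open>0\<close>, after which nothing but \<open>0\<close> can follow.\<close>
  have "last lx \<noteq> 3 * m - 1"
  proof
    assume max: "last lx = 3 * m - 1"
    have "j \<in> \<gamma> ` set lz" using split(3) j by (metis atLeastLessThan_iff le0 set_map set_rev set_upt)
    then obtain y where y: "y \<in> set lz" "\<gamma> y = j" by blast
    then have "3 * m - 1 \<le> y" using le[of "last lx" y] last_in_set[OF ne] max by simp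
    moreover have "y < 3 * m" using y ls(2) unfolding split(1) by auto
    ultimately have "y = last lx" using max by simp
    then show False using y last j by simp
  qed
  then have "last lx \<le> m" using gamma_eq_iff[OF lt m] last \<pi> by auto
  then have "{m + 1, 3 * m - 1 - j} \<subseteq> set lz"
  proof -
    have "m + 1 < 3 * m" "3 * m - 1 - j < 3 * m" "m < m + 1" "m < 3 * m - 1 - j" using j by auto
    then show ?thesis using ls(2) lx_le \<open>last lx \<le> m\<close> unfolding split(1) by force
  qed
  moreover have "inj_on \<gamma> (set lz)"
    using split(3) by (metis distinct_map distinct_rev distinct_upt)
  moreover have "\<gamma> (m + 1) = j" "\<gamma> (3 * m - 1 - j) = j"
    using gamma_eq_iff[of _ j] j \<pi> by auto
  ultimately have "m + 1 = 3 * m - 1 - j" by (auto dest: inj_onD)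
  then show False using j by simp
qed

theorem theorem2p1:
  fixes M :: "('a, 'b) monoid_scheme"
  assumes "monoid M"
    and "property_C 5 M"
    and "\<And>n::nat. n > 3 \<Longrightarrow> \<exists>k\<ge>1.
           satisfies M (linear_word n @ J_word n k @ rev (linear_word n))
                       (linear_word n @ rev (J_word n k) @ rev (linear_word n))"
  shows "\<not> finitely_based M"
proof
  assume "finitely_based M"
  then obtain \<Sigma> where \<Sigma>: "finite \<Sigma>" "\<Sigma> \<subseteq> identities_of M"
    "\<And>u v. satisfies M u v \<Longrightarrow> deducible \<Sigma> u v"
    unfolding finitely_based_def identities_of_def by auto
  obtain r where r: "\<And>u v. (u, v) \<in> \<Sigma> \<Longrightarrow> card (set u) \<le> r"
  proof -
    have "card (set u) \<le> Max ((\<lambda>(u, v). card (set u)) ` \<Sigma>)" if "(u, v) \<in> \<Sigma>" for u v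
      using \<Sigma>(1) that by (intro Max_ge) force+
    then show thesis using that by blast
  qed
  \<comment> \<open>The bound \<open>r + 2\<close> includes the two letters that carry the context; \<open>n\<close> exceeds it by a margin.\<close>
  define n where "n = r + 5"
  define m where "m = n * n - 1"
  interpret zigzag m "r + 2" "grid_swap n" "grid_swap n"
    unfolding m_def by (rule grid_swap_zigzag) (auto simp: n_def)
  obtain k where k: "1 \<le> k" and sat: "satisfies M (linear_word n @ J_word n k @ rev (linear_word n))
                       (linear_word n @ rev (J_word n k) @ rev (linear_word n))"
    using assms(3)[of n] by (auto simp: n_def)
  let ?J = "concat (map (\<lambda>q. replicate k (grid_swap n q)) [0..<m])"
  define \<Theta> where "\<Theta> x = (if 0 < x \<and> x \<le> m then [x - 1] else [])" for x
  have "follows_zigzag ([] @ concat (map \<Theta> (linear_word n @ J_word n k @ rev (linear_word n))) @ [])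
    \<longleftrightarrow> follows_zigzag ([] @ concat (map \<Theta> (linear_word n @ rev (J_word n k) @ rev (linear_word n))) @ [])"
  proof (rule deducible_preserves_zigzag)
    show "deducible \<Sigma> (linear_word n @ J_word n k @ rev (linear_word n))
                       (linear_word n @ rev (J_word n k) @ rev (linear_word n))"
      using \<Sigma>(3) sat by blast
    fix u v assume uv: "(u, v) \<in> \<Sigma>"
    then have "satisfies M u v" using \<Sigma>(2) by (auto simp: identities_of_def)
    moreover from this have "satisfies M v u" by (auto simp: satisfies_def)
    ultimately show "type_faithful u v \<and> type_faithful v u \<and> card (set u) + 2 \<le> r + 2"
      using satisfies_imp_type_faithful[OF assms(1,2)] r[OF uv] by simp
  qed
  moreover have "0 < n" by (simp add: n_def)
  note proj = J_word_project[OF this, folded m_def, folded \<Theta>_def[abs_def]]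
  have "concat (map \<Theta> (linear_word n @ J_word n k @ rev (linear_word n))) = [0..<m] @ ?J @ rev [0..<m]"
    "concat (map \<Theta> (linear_word n @ rev (J_word n k) @ rev (linear_word n))) = [0..<m] @ rev ?J @ rev [0..<m]"
    using proj by simp_all
  ultimately have "follows_zigzag ([0..<m] @ ?J @ rev [0..<m]) \<longleftrightarrow> follows_zigzag ([0..<m] @ rev ?J @ rev [0..<m])"
    by simp
  moreover have "follows_zigzag ([0..<m] @ ?J @ rev [0..<m])" by (rule follows_zigzag_intro[OF k])
  moreover have "\<not> follows_zigzag ([0..<m] @ rev ?J @ rev [0..<m])"
  proof (rule not_follows_zigzag_rev[OF k])
    have "5 * n \<le> n * n" by (intro mult_le_mono1) (simp add: n_def)
    then show "n < m" using \<open>0 < n\<close> unfolding m_def by linarith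
  qed (auto simp: n_def grid_swap_def)
  ultimately show False by blast
qed

end
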